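(* Let $S$ be a locally compact semigroup. Then $S$ has cancellation if and only if for every non-zero $\mu\in C_0(S)^*$ the linear spans of the sets $$\{g\star(\mu\cdot f) : f,g\in C_0(S)\}\quad\text{and}\quad\{(g\cdot\mu)\star f : f,g\in C_0(S)\}$$ are both strictly dense in $M(C_0(S))=C_b(S)$.
   Context: A locally compact semigroup is a locally compact Hausdorff space $S$ with a jointly continuous associative multiplication. $S$ has cancellation if it is cancellative from the left and from the right: $xy=xy'$ implies $y=y'$, and $xy=x'y$ implies $x=x'$; equivalently, both maps $S\times S\to S\times S$, $(x,y)\mapsto(x,xy)$ and $(x,y)\mapsto(xy,y)$, are injective. $C_0(S)$ is the $C^*$-algebra of continuous complex functions vanishing at infinity, and $M(C_0(S))=C_b(S)$ is its multiplier algebra (bounded continuous functions). The strict topology on $M(A)$ is given by the seminorms $x\mapsto\|xa\|$ and $x\mapsto\|ax\|$, $a\in A$. The comultiplication is $\Delta_S:C_0(S)\to M(C_0(S)\otimes C_0(S))=C_b(S\times S)$, $\Delta_S(f)(x,y)=f(xy)$. For $\mu\in C_0(S)^*$ and $a,b\in C_0(S)$: $(a\cdot\mu)(b)=\mu(ba)$ and $(\mu\cdot b)(a)=\mu(ba)$. The convolutions are $\mu\star a=(\mathrm{id}\otimes\mu)\Delta_S(a)\in M(C_0(S))$ and $a\star\mu=(\mu\otimes\mathrm{id})\Delta_S(a)\in M(C_0(S))$, where slice maps are extended to multipliers by strict continuity. Thus $g\star(\mu\cdot f)=(\mu\otimes\mathrm{id})\bigl((f\otimes 1)\Delta_S(g)\bigr)$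 and $(g\cdot\mu)\star f=(\mathrm{id}\otimes\mu)\bigl(\Delta_S(f)(1\otimes g)\bigr)$. *)

theory Defs
  imports "HOL-Analysis.Analysis"
begin

text \<open>
  For a locally compact Hausdorff space \<open>'a\<close>, the multiplier algebra \<open>M(C\<^sub>0('a)) = C\<^sub>b('a)\<close> is the
  type \<open>'a \<Rightarrow>\<^sub>C complex\<close> with its supremum norm. The library provides neither its complex scalar
  multiplication nor its product, so both are added here.
\<close>

definition cb_scale :: "complex \<Rightarrow> ('a::topological_space \<Rightarrow>\<^sub>C complex) \<Rightarrow> ('a \<Rightarrow>\<^sub>C complex)"
  where "cb_scale c f = Bcontfun (\<lambda>x. c * f x)"

definition cb_mult ::
    "('a::topological_space \<Rightarrow>\<^sub>C complex) \<Rightarrow> ('a \<Rightarrow>\<^sub>C complex) \<Rightarrow> ('a \<Rightarrow>\<^sub>C complex)"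
    (infixl \<open>\<bullet>\<^sub>C\<close> 70)
  where "f \<bullet>\<^sub>C g = Bcontfun (\<lambda>x. f x * g x)"

lemma cb_scale_apply [simp]: "cb_scale c f x = c * f x"
proof -
  have "(\<lambda>x. c * f x) \<in> bcontfun"
    by (rule bcontfun_normI[where b = "norm c * norm f"])
      (auto intro!: continuous_intros mult_left_mono norm_bounded simp: norm_mult)
  then show ?thesis
    by (simp add: cb_scale_def Bcontfun_inverse)
qed

lemma cb_mult_apply [simp]: "(f \<bullet>\<^sub>C g) x = f x * g x"
proof -
  have "(\<lambda>x. f x * g x) \<in> bcontfun"
    by (rule bcontfun_normI[where b = "norm f * norm g"])
      (auto intro!: continuous_intros mult_mono norm_bounded simp: norm_mult)
  then show ?thesis
    by (simp add: cb_mult_def Bcontfun_inverse)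
qed

lemma vector_space_cb_scale: "vector_space cb_scale"
  by unfold_locales (auto intro!: bcontfun_eqI simp: algebra_simps)

definition C0 :: "('a::topological_space \<Rightarrow>\<^sub>C complex) set"
  where "C0 = {f :: 'a \<Rightarrow>\<^sub>C complex. \<forall>e>0. \<exists>K. compact K \<and> (\<forall>x. x \<notin> K \<longrightarrow> norm (f x) < e)}"

text \<open>
  Elements of \<open>C\<^sub>0('a)\<^sup>*\<close> are represented by functions on all of \<open>C\<^sub>b('a)\<close> of which only the restriction
  to \<open>C0\<close> is constrained; every notion below depends on that restriction only.
\<close>

definition C0_dual :: "(('a::topological_space \<Rightarrow>\<^sub>C complex) \<Rightarrow> complex) set"
  where "C0_dual = {\<mu>.
    (\<forall>f\<in>C0. \<forall>g\<in>C0. \<mu> (f + g) = \<mu> f + \<mu> g) \<and>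
    (\<forall>c. \<forall>f\<in>C0. \<mu> (cb_scale c f) = c * \<mu> f) \<and>
    (\<exists>B. \<forall>f\<in>C0. norm (\<mu> f) \<le> B * norm f)}"

definition strict_topology :: "('a::topological_space \<Rightarrow>\<^sub>C complex) topology"
  where "strict_topology = topology_generated_by
    ({{x. norm ((x - h) \<bullet>\<^sub>C a) < e} | h a e. a \<in> C0 \<and> e > 0} \<union>
     {{x. norm (a \<bullet>\<^sub>C (x - h)) < e} | h a e. a \<in> C0 \<and> e > 0})"

definition strictly_dense :: "('a::topological_space \<Rightarrow>\<^sub>C complex) set \<Rightarrow> bool"
  where "strictly_dense X \<longleftrightarrow> strict_topology closure_of X = UNIV"

definition left_act ::
    "('a::topological_space \<Rightarrow>\<^sub>C complex) \<Rightarrow> (('a \<Rightarrow>\<^sub>C complex) \<Rightarrow> complex)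
      \<Rightarrow> (('a \<Rightarrow>\<^sub>C complex) \<Rightarrow> complex)"
  where "left_act a \<mu> = (\<lambda>b. \<mu> (b \<bullet>\<^sub>C a))"

definition right_act ::
    "(('a::topological_space \<Rightarrow>\<^sub>C complex) \<Rightarrow> complex) \<Rightarrow> ('a \<Rightarrow>\<^sub>C complex)
      \<Rightarrow> (('a \<Rightarrow>\<^sub>C complex) \<Rightarrow> complex)"
  where "right_act \<mu> b = (\<lambda>a. \<mu> (b \<bullet>\<^sub>C a))"

definition tensor ::
    "('a::topological_space \<Rightarrow>\<^sub>C complex) \<Rightarrow> ('b::topological_space \<Rightarrow>\<^sub>C complex)
      \<Rightarrow> (('a \<times> 'b) \<Rightarrow>\<^sub>C complex)"
  where "tensor a b = Bcontfun (\<lambda>(x, y). a x * b y)"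

lemma tensor_apply [simp]: "tensor a b (x, y) = a x * b y"
proof -
  have "continuous_on UNIV (\<lambda>z. a (fst z) * b (snd z))"
    by (intro continuous_intros continuous_on_compose2[OF continuous_on_apply_bcontfun]) auto
  then have "(\<lambda>z. a (fst z) * b (snd z)) \<in> bcontfun"
    by (rule bcontfun_normI[where b = "norm a * norm b"])
      (auto intro!: mult_mono norm_bounded simp: norm_mult)
  then show ?thesis
    by (simp add: tensor_def case_prod_unfold Bcontfun_inverse)
qed

text \<open>
  The slice maps \<open>id \<otimes> \<mu>\<close> and \<open>\<mu> \<otimes> id\<close> from \<open>M(C\<^sub>0 \<otimes> C\<^sub>0) = C\<^sub>b('a \<times> 'a)\<close> to \<open>M(C\<^sub>0) = C\<^sub>b('a)\<close>: the
  linear, strictly continuous extensions of \<open>a \<otimes> b \<mapsto> \<mu>(b) a\<close> and \<open>a \<otimes> b \<mapsto> \<mu>(a) b\<close>. For \<open>\<mu>\<close> in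
  \<open>C0_dual\<close> the extension exists because \<open>\<mu>\<close> factors as \<open>a \<cdot> \<nu>\<close> with \<open>a\<close> in \<open>C0\<close> and \<open>\<nu>\<close> in
  \<open>C0_dual\<close>; it is unique because the span of the elementary tensors is strictly dense.
\<close>

definition id_slice ::
    "(('a::topological_space \<Rightarrow>\<^sub>C complex) \<Rightarrow> complex)
      \<Rightarrow> (('a \<times> 'a) \<Rightarrow>\<^sub>C complex) \<Rightarrow> ('a \<Rightarrow>\<^sub>C complex)"
  where "id_slice \<mu> = (THE T.
    Vector_Spaces.linear cb_scale cb_scale T \<and>
    continuous_map strict_topology strict_topology T \<and>
    (\<forall>a\<in>C0. \<forall>b\<in>C0. T (tensor a b) = cb_scale (\<mu> b) a))"

definition slice_id ::
    "(('a::topological_space \<Rightarrow>\<^sub>C complex) \<Rightarrow> complex)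
      \<Rightarrow> (('a \<times> 'a) \<Rightarrow>\<^sub>C complex) \<Rightarrow> ('a \<Rightarrow>\<^sub>C complex)"
  where "slice_id \<mu> = (THE T.
    Vector_Spaces.linear cb_scale cb_scale T \<and>
    continuous_map strict_topology strict_topology T \<and>
    (\<forall>a\<in>C0. \<forall>b\<in>C0. T (tensor a b) = cb_scale (\<mu> a) b))"

definition comult ::
    "('a::topological_semigroup_mult \<Rightarrow>\<^sub>C complex) \<Rightarrow> (('a \<times> 'a) \<Rightarrow>\<^sub>C complex)"
  where "comult f = Bcontfun (\<lambda>(x, y). f (x * y))"

lemma comult_apply [simp]: "comult f (x, y) = f (x * y)"
proof -
  have "continuous_on UNIV (\<lambda>z::'a \<times> 'a. fst z * snd z)"
    unfolding continuous_on_def by (intro ballI tendsto_mult tendsto_fst tendsto_snd tendsto_ident_at)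
  then have "continuous_on UNIV (\<lambda>z. f (fst z * snd z))"
    by (rule continuous_on_compose2[OF continuous_on_apply_bcontfun]) auto
  then have "(\<lambda>z. f (fst z * snd z)) \<in> bcontfun"
    by (rule bcontfun_normI[where b = "norm f"]) (rule norm_bounded)
  then show ?thesis
    by (simp add: comult_def case_prod_unfold Bcontfun_inverse)
qed

text \<open>The convolutions \<open>\<mu> \<star> a = (id \<otimes> \<mu>) \<Delta>(a)\<close> and \<open>a \<star> \<mu> = (\<mu> \<otimes> id) \<Delta>(a)\<close>.\<close>

definition dual_conv ::
    "(('a::topological_semigroup_mult \<Rightarrow>\<^sub>C complex) \<Rightarrow> complex) \<Rightarrow> ('a \<Rightarrow>\<^sub>C complex)
      \<Rightarrow> ('a \<Rightarrow>\<^sub>C complex)"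
  where "dual_conv \<mu> a = id_slice \<mu> (comult a)"

definition conv_dual ::
    "('a::topological_semigroup_mult \<Rightarrow>\<^sub>C complex) \<Rightarrow> (('a \<Rightarrow>\<^sub>C complex) \<Rightarrow> complex)
      \<Rightarrow> ('a \<Rightarrow>\<^sub>C complex)"
  where "conv_dual a \<mu> = slice_id \<mu> (comult a)"

end

theory Submission
  imports Defs
begin

text \<open>
  Both spans are images of sets of functions on \<open>S \<times> S\<close> under slice maps. Since
  \<open>g \<star> (\<mu> \<cdot> f) = (\<mu> \<otimes> id) ((f \<otimes> 1) \<Delta> g)\<close>, the first one is the image under \<open>\<mu> \<otimes> id\<close> of the span of the
  functions \<open>(x, y) \<mapsto> f x * g (x * y)\<close>. These functions are closed under products and conjugation and
  have no common zero. If \<open>S\<close> is left cancellative, then \<open>(x, y) \<mapsto> (x, x * y)\<close> is injective, so that they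
  also separate the points of \<open>S \<times> S\<close>, and their span is strictly dense by a Stone--Weierstrass theorem
  for the strict topology (\<open>strict_Stone_Weierstrass\<close>). The slice map is strictly continuous, and for
  \<open>\<mu> \<noteq> 0\<close> it maps the elementary tensors onto a set containing \<open>C0\<close>, which is itself strictly dense.
  Hence the image of the span is strictly dense too. The second span is treated in the same way, with
  \<open>id \<otimes> \<mu>\<close>, the functions \<open>(x, y) \<mapsto> f (x * y) * g y\<close> and right cancellation.

  For the converse, let \<open>\<mu>\<close> be the evaluation at \<open>x\<close>. The first span then consists of combinations of the
  functions \<open>y \<mapsto> f x * g (x * y)\<close>, which take the same value at \<open>y\<close> and \<open>y'\<close> if \<open>x * y = x * y'\<close>. A
  strictly dense set separates points, so \<open>y = y'\<close>.

  It remains to see that the slice maps exist and are unique. Uniqueness is the strict density of the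
  span of the elementary tensors, again by Stone--Weierstrass. For existence, every bounded
  functional satisfies \<open>|\<mu> h| \<le> C \<parallel>h a\<parallel>\<close> for a single \<open>a\<close> in \<open>C0\<close> (\<open>C0_dual_strict_bound\<close>). It therefore
  extends to all bounded continuous functions with the same bound (\<open>C0_dual_strict_extension\<close>), and the
  extension can be applied to the sections of a function of two variables (\<open>slice_exists\<close>).
\<close>

section \<open>Bounded continuous functions and functions vanishing at infinity\<close>

interpretation cb: vector_space "cb_scale :: complex \<Rightarrow> ('a::topological_space \<Rightarrow>\<^sub>C complex) \<Rightarrow> _"
  by (rule vector_space_cb_scale)

lemma apply_Bcontfun:
  assumes "continuous_on UNIV f" "\<And>x. norm (f x) \<le> B"
  shows "apply_bcontfun (Bcontfun f) x = f x"
  using bcontfun_normI[OF assms] by (simp add: Bcontfun_inverse)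

lemma cb_mult_commute: "f \<bullet>\<^sub>C g = g \<bullet>\<^sub>C f"
  by (rule bcontfun_eqI) simp

lemma cb_mult_scale_left: "cb_scale c f \<bullet>\<^sub>C g = cb_scale c (f \<bullet>\<^sub>C g)"
  by (rule bcontfun_eqI) simp

lemma cb_mult_add_left: "(f + h) \<bullet>\<^sub>C g = f \<bullet>\<^sub>C g + h \<bullet>\<^sub>C g"
  by (rule bcontfun_eqI) (simp add: algebra_simps)

lemma cb_mult_diff_left: "(f - h) \<bullet>\<^sub>C g = f \<bullet>\<^sub>C g - h \<bullet>\<^sub>C g"
  by (rule bcontfun_eqI) (simp add: algebra_simps)

lemma cb_mult_zero_left: "0 \<bullet>\<^sub>C f = 0"
  by (rule bcontfun_eqI) simp

lemma norm_cb_scale: "norm (cb_scale c f) = norm c * norm f"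
proof (cases "c = 0")
  case True
  then show ?thesis by simp
next
  case False
  have le: "norm (cb_scale d g) \<le> norm d * norm g" for d and g :: "'a \<Rightarrow>\<^sub>C complex"
    by (rule norm_bound) (simp add: norm_mult mult_left_mono norm_bounded)
  have "norm f = norm (cb_scale (inverse c) (cb_scale c f))" using False by simp
  also have "\<dots> \<le> norm (inverse c) * norm (cb_scale c f)" by (rule le)
  finally have "norm c * norm f \<le> norm c * (norm (inverse c) * norm (cb_scale c f))"
    by (rule mult_left_mono) simp
  also have "\<dots> = norm (cb_scale c f)" using False by (simp add: norm_inverse)
  finally show ?thesis using le[of c f] by simp
qed

lemma norm_cb_mult: "norm (f \<bullet>\<^sub>C g) \<le> norm f * norm g"
  by (rule norm_bound) (simp add: norm_mult mult_mono norm_bounded)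

lemma norm_bcontfun_mono:
  fixes f :: "'a::topological_space \<Rightarrow>\<^sub>C complex" and g :: "'b::topological_space \<Rightarrow>\<^sub>C complex"
  assumes "\<And>x. \<exists>y. norm (f x) \<le> C * norm (g y)" "C \<ge> 0"
  shows "norm f \<le> C * norm g"
  by (rule norm_bound) (meson assms mult_left_mono norm_bounded order_trans)

definition cb_cnj :: "('a::topological_space \<Rightarrow>\<^sub>C complex) \<Rightarrow> ('a \<Rightarrow>\<^sub>C complex)"
  where "cb_cnj f = Bcontfun (\<lambda>x. cnj (f x))"

lemma cb_cnj_apply [simp]: "cb_cnj f x = cnj (f x)"
  unfolding cb_cnj_def
  by (rule apply_Bcontfun[where B = "norm f"]) (auto intro!: continuous_intros simp: norm_bounded)

definition cb_swap :: "(('a::topological_space \<times> 'b::topological_space) \<Rightarrow>\<^sub>C complex) \<Rightarrow> (('b \<times> 'a) \<Rightarrow>\<^sub>C complex)"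
  where "cb_swap F = Bcontfun (\<lambda>z. F (snd z, fst z))"

lemma cb_swap_apply [simp]: "cb_swap F (x, y) = F (y, x)"
proof -
  have "continuous_on UNIV (\<lambda>z. F (snd z, fst z))"
    by (rule continuous_on_compose2[OF continuous_on_apply_bcontfun]) (auto intro!: continuous_intros)
  then show ?thesis
    unfolding cb_swap_def by (subst apply_Bcontfun[where B = "norm F"]) (auto simp: norm_bounded)
qed

definition cb_section :: "(('a::topological_space \<times> 'b::topological_space) \<Rightarrow>\<^sub>C complex) \<Rightarrow> 'a \<Rightarrow> ('b \<Rightarrow>\<^sub>C complex)"
  where "cb_section F x = Bcontfun (\<lambda>y. F (x, y))"

lemma cb_section_apply [simp]: "cb_section F x y = F (x, y)"
proof -
  have "continuous_on UNIV (\<lambda>y. F (x, y))"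
    by (rule continuous_on_compose2[OF continuous_on_apply_bcontfun]) (auto intro!: continuous_intros)
  then show ?thesis
    unfolding cb_section_def by (rule apply_Bcontfun[where B = "norm F"]) (auto simp: norm_bounded)
qed

lemma C0_dominated:
  fixes f g :: "'a::topological_space \<Rightarrow>\<^sub>C complex"
  assumes "f \<in> C0" "\<And>x. norm (g x) \<le> C * norm (f x)"
  shows "g \<in> C0"
  unfolding C0_def
proof (intro CollectI allI impI)
  fix e :: real assume "e > 0"
  then have "e / (\<bar>C\<bar> + 1) > 0" by auto
  then obtain K where K: "compact K" "\<And>x. x \<notin> K \<Longrightarrow> norm (f x) < e / (\<bar>C\<bar> + 1)"
    using assms(1) unfolding C0_def by blast
  have "norm (g x) < e" if "x \<notin> K" for x
  proof -
    have "norm (g x) \<le> (\<bar>C\<bar> + 1) * norm (f x)"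
      using assms(2)[of x] mult_right_mono[of C "\<bar>C\<bar> + 1" "norm (f x)"] by fastforce
    also have "\<dots> < (\<bar>C\<bar> + 1) * (e / (\<bar>C\<bar> + 1))"
      using K(2)[OF that] by (intro mult_strict_left_mono) auto
    also have "\<dots> = e" by (simp add: field_simps)
    finally show ?thesis .
  qed
  then show "\<exists>K. compact K \<and> (\<forall>x. x \<notin> K \<longrightarrow> norm (g x) < e)" using K(1) by blast
qed

lemma C0_scale: "f \<in> C0 \<Longrightarrow> cb_scale c f \<in> C0"
  by (erule C0_dominated[where C = "norm c"]) (simp add: norm_mult)

lemma C0_cnj: "f \<in> C0 \<Longrightarrow> cb_cnj f \<in> C0"
  by (erule C0_dominated[where C = 1]) simp

lemma C0_mult_left: "f \<in> C0 \<Longrightarrow> f \<bullet>\<^sub>C g \<in> C0"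
  by (erule C0_dominated[where C = "norm g"])
    (simp add: norm_mult mult.commute[of "norm (apply_bcontfun f _)"] mult_right_mono norm_bounded)

lemma C0_mult_right: "f \<in> C0 \<Longrightarrow> g \<bullet>\<^sub>C f \<in> C0"
  by (metis C0_mult_left cb_mult_commute)

text \<open>
  Taking \<open>c = |a| + |b|\<close> makes the seminorms \<open>f \<mapsto> \<parallel>f a\<parallel>\<close> of the strict topology a directed family,
  so that a single one of them controls any finite number.
\<close>

lemma C0_common_dominator:
  assumes "a \<in> C0" "b \<in> C0"
  obtains c where "c \<in> C0" "\<And>x. norm (a x) \<le> norm (c x)" "\<And>x. norm (b x) \<le> norm (c x)"
proof -
  define c where "c = Bcontfun (\<lambda>x. complex_of_real (norm (a x) + norm (b x)))"
  have c: "c x = complex_of_real (norm (a x) + norm (b x))" for x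
    unfolding c_def
    by (rule apply_Bcontfun[where B = "norm a + norm b"])
      (auto intro!: continuous_intros add_mono simp: norm_bounded simp flip: of_real_add)
  have nc: "norm (c x) = norm (a x) + norm (b x)" for x
    unfolding c norm_of_real by simp
  have "c \<in> C0"
    unfolding C0_def
  proof (intro CollectI allI impI)
    fix e :: real assume "e > 0"
    then have "e/2 > 0" by simp
    then obtain K L where K: "compact K" "\<And>x. x \<notin> K \<Longrightarrow> norm (a x) < e/2"
      and L: "compact L" "\<And>x. x \<notin> L \<Longrightarrow> norm (b x) < e/2"
      using assms unfolding C0_def by blast
    have "norm (c x) < e" if "x \<notin> K \<union> L" for x
      using K(2)[of x] L(2)[of x] that by (auto simp: nc)
    then show "\<exists>K. compact K \<and> (\<forall>x. x \<notin> K \<longrightarrow> norm (c x) < e)"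
      using compact_Un[OF K(1) L(1)] by blast
  qed
  then show thesis using that by (simp add: nc)
qed

lemma C0_add:
  assumes "a \<in> C0" "b \<in> C0" shows "a + b \<in> C0"
proof -
  obtain c where c: "c \<in> C0" "\<And>x. norm (a x) \<le> norm (c x)" "\<And>x. norm (b x) \<le> norm (c x)"
    using C0_common_dominator[OF assms] by blast
  show ?thesis
  proof (rule C0_dominated[OF c(1), where C = 2])
    show "norm ((a + b) x) \<le> 2 * norm (c x)" for x
      using c(2)[of x] c(3)[of x] norm_triangle_ineq[of "a x" "b x"] by simp
  qed
qed

lemma C0_0: "0 \<in> C0"
  unfolding C0_def by (auto intro!: exI[of _ "{}"])

lemma C0_diff: "a \<in> C0 \<Longrightarrow> b \<in> C0 \<Longrightarrow> a - b \<in> C0"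
  using C0_add[of a "cb_scale (-1) b"] C0_scale[of b "-1"] by simp

lemma tensor_C0:
  assumes "a \<in> C0" "b \<in> C0" shows "tensor a b \<in> C0"
  unfolding C0_def
proof (intro CollectI allI impI)
  fix e :: real assume e: "e > 0"
  let ?M = "norm a + norm b + 1"
  have M: "?M > 0" using norm_ge_zero[of a] norm_ge_zero[of b] by linarith
  then have "e / ?M > 0" using e by simp
  then obtain K L where K: "compact K" "\<And>x. x \<notin> K \<Longrightarrow> norm (a x) < e / ?M"
    and L: "compact L" "\<And>x. x \<notin> L \<Longrightarrow> norm (b x) < e / ?M"
    using assms unfolding C0_def by blast
  have "norm (tensor a b z) < e" if "z \<notin> K \<times> L" for z
  proof -
    obtain x y where z: "z = (x, y)" by force
    have b: "norm (a x) \<le> ?M" "norm (b y) \<le> ?M"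
      using norm_bounded[of a x] norm_bounded[of b y] norm_ge_zero[of a] norm_ge_zero[of b] by linarith+
    have "x \<notin> K \<or> y \<notin> L" using that z by simp
    then show ?thesis
    proof
      assume 1: "x \<notin> K"
      have "norm (a x) * norm (b y) \<le> norm (a x) * ?M" by (intro mult_left_mono b) auto
      also have "\<dots> < e / ?M * ?M" by (intro mult_strict_right_mono K 1 M)
      finally show ?thesis using M by (simp add: z norm_mult)
    next
      assume 2: "y \<notin> L"
      have "norm (a x) * norm (b y) \<le> ?M * norm (b y)" by (intro mult_right_mono b) auto
      also have "\<dots> < ?M * (e / ?M)" by (intro mult_strict_left_mono L 2 M)
      finally show ?thesis using M by (simp add: z norm_mult)
    qed
  qed
  then show "\<exists>K. compact K \<and> (\<forall>x. x \<notin> K \<longrightarrow> norm (tensor a b x) < e)"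
    using compact_Times[OF K(1) L(1)] by blast
qed

text \<open>
  A locally compact Hausdorff space is completely regular. Applied to \<open>x\<close> and the closed set consisting
  of \<open>y\<close> and of the complement of a relatively compact neighbourhood of \<open>x\<close>, this gives a function
  with compact support.
\<close>

lemma C0_separates:
  fixes x y :: "'a::t2_space"
  assumes lc: "locally_compact_space (euclidean :: 'a topology)" and "x \<noteq> y"
  obtains f where "f \<in> C0" "f x = 1" "f y = 0"
proof -
  have "Hausdorff_space (euclidean :: 'a topology)"
    unfolding Hausdorff_space_def disjnt_def using hausdorff by simp meson
  then have "completely_regular_space (euclidean :: 'a topology)"
    by (intro locally_compact_regular_imp_completely_regular_space lc
        disjI1) simp
  obtain U K where U: "open U" "compact K" "x \<in> U" "U \<subseteq> K"
    using lc unfolding locally_compact_space_def by simp meson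
  have "closed (- U \<union> {y})" and "x \<notin> - U \<union> {y}"
    using U assms by (simp_all only: closed_Un closed_singleton closed_Compl) simp
  then obtain p :: "'a \<Rightarrow> real" where p: "continuous_map euclidean (top_of_set {0..1}) p"
    "p x = 0" "p ` (- U \<union> {y}) \<subseteq> {1}"
    using \<open>completely_regular_space euclidean\<close> unfolding completely_regular_space_def
      closed_closedin topspace_euclidean by blast
  have cp: "continuous_on UNIV p" and p01: "\<And>z. 0 \<le> p z \<and> p z \<le> 1"
    using p(1) by (auto simp: continuous_map_in_subtopology image_subset_iff)
  define f where "f = Bcontfun (\<lambda>z. complex_of_real (1 - p z))"
  have f: "f z = complex_of_real (1 - p z)" for z
    unfolding f_def
    by (rule apply_Bcontfun[where B = 1])
      (use p01 in \<open>auto intro!: continuous_intros cp simp del: of_real_diff simp: norm_of_real\<close>)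
  have "f \<in> C0"
    unfolding C0_def
  proof (intro CollectI allI impI exI conjI)
    show "compact K" by fact
    show "norm (f z) < e" if "e > 0" "z \<notin> K" for e z
    proof -
      have "z \<in> - U" using that U by auto
      then have "p z = 1" using p(3) by blast
      then show ?thesis using that by (simp add: f)
    qed
  qed
  moreover have "f x = 1" "f y = 0" using p by (auto simp: f)
  ultimately show thesis using that by blast
qed

lemma C0_nonvanishing:
  fixes x :: "'a::t2_space"
  assumes lc: "locally_compact_space (euclidean :: 'a topology)"
  obtains f where "f \<in> C0" "f x = 1"
proof (cases "\<exists>y. y \<noteq> x")
  case True
  then show ?thesis using C0_separates[OF lc] that by metis
next
  case False
  \<comment> \<open>a one-point space is compact, so constants vanish at infinity\<close>
  then have "compact (UNIV :: 'a set)" using compact_insert[OF compact_empty, of x] by (metis UNIV_eq_I insertI1)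
  then have "const_bcontfun 1 \<in> (C0 :: ('a \<Rightarrow>\<^sub>C complex) set)"
    unfolding C0_def by blast
  then show ?thesis using that by force
qed

section \<open>The strict topology\<close>

text \<open>
  The defining sets of the strict topology form only a subbase. Since the seminorms are directed, the
  seminorm balls around a point are already a base of its neighbourhoods, which is the form in which
  the topology is used from here on.
\<close>

lemma openin_strict_iff:
  fixes U :: "('a::topological_space \<Rightarrow>\<^sub>C complex) set"
  shows "openin strict_topology U \<longleftrightarrow>
    (\<forall>h\<in>U. \<exists>a\<in>C0. \<exists>e>0. {x. norm ((x - h) \<bullet>\<^sub>C a) < e} \<subseteq> U)" (is "?L \<longleftrightarrow> ?R")
proof
  let ?B = "({{x. norm ((x - h) \<bullet>\<^sub>C a) < e} | h a e. a \<in> C0 \<and> e > 0} \<union>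
     {{x. norm (a \<bullet>\<^sub>C (x - h)) < e} | h a e. a \<in> C0 \<and> e > 0})
     :: ('a \<Rightarrow>\<^sub>C complex) set set"
  have B: "?B = {{x. norm ((x - h) \<bullet>\<^sub>C a) < e} | h a e. a \<in> C0 \<and> e > 0}"
    by (subst (2) cb_mult_commute) simp
  show ?R if ?L
  proof -
    have "generate_topology_on {{x. norm ((x - h) \<bullet>\<^sub>C a) < e} | h a e. a \<in> C0 \<and> e > 0} U"
      using that unfolding strict_topology_def B by (rule openin_topology_generated_by)
    then show ?R
    proof induction
      case Empty
      show ?case by simp
    next
      case (Int U V)
      show ?case
      proof
        fix h assume "h \<in> U \<inter> V"
        then obtain a d b e where a: "a \<in> C0" "d > 0" "{x. norm ((x - h) \<bullet>\<^sub>C a) < d} \<subseteq> U"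
          and b: "b \<in> C0" "e > 0" "{x. norm ((x - h) \<bullet>\<^sub>C b) < e} \<subseteq> V"
          using Int.IH by (meson IntD1 IntD2)
        obtain c where c: "c \<in> C0" "\<And>x. norm (a x) \<le> norm (c x)" "\<And>x. norm (b x) \<le> norm (c x)"
          using C0_common_dominator[OF a(1) b(1)] by blast
        have "norm (f \<bullet>\<^sub>C a) \<le> 1 * norm (f \<bullet>\<^sub>C c)" "norm (f \<bullet>\<^sub>C b) \<le> 1 * norm (f \<bullet>\<^sub>C c)" for f
          by (intro norm_bcontfun_mono; auto simp: norm_mult intro!: mult_left_mono c exI)+
        then have "{x. norm ((x - h) \<bullet>\<^sub>C c) < min d e} \<subseteq> U \<inter> V"
          using a(3) b(3) by (fastforce intro: order.strict_trans1)
        then show "\<exists>a\<in>C0. \<exists>e>0. {x. norm ((x - h) \<bullet>\<^sub>C a) < e} \<subseteq> U \<inter> V"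
          using c(1) a(2) b(2) by (intro bexI[OF _ c(1)] exI[of _ "min d e"]) simp
      qed
    next
      case (UN K)
      then show ?case by (meson UnionE Union_upper order_trans)
    next
      case (Basis s)
      then obtain h a e where s: "s = {x. norm ((x - h) \<bullet>\<^sub>C a) < e}" "a \<in> C0" "e > 0" by blast
      show ?case
      proof
        fix k assume "k \<in> s"
        then have pos: "e - norm ((k - h) \<bullet>\<^sub>C a) > 0" using s by simp
        have "norm ((x - h) \<bullet>\<^sub>C a) < e" if "norm ((x - k) \<bullet>\<^sub>C a) < e - norm ((k - h) \<bullet>\<^sub>C a)" for x
          using that norm_triangle_ineq[of "(x - k) \<bullet>\<^sub>C a" "(k - h) \<bullet>\<^sub>C a"]
          by (simp add: cb_mult_diff_left)
        then show "\<exists>a\<in>C0. \<exists>e>0. {x. norm ((x - k) \<bullet>\<^sub>C a) < e} \<subseteq> s"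
          using pos s by blast
      qed
    qed
  qed
  show ?L if ?R
  proof (subst openin_subopen, intro ballI)
    fix h assume "h \<in> U"
    then obtain a e where a: "a \<in> C0" "e > 0" "{x. norm ((x - h) \<bullet>\<^sub>C a) < e} \<subseteq> U"
      using \<open>?R\<close> by blast
    have "openin strict_topology {x. norm ((x - h) \<bullet>\<^sub>C a) < e}"
      unfolding strict_topology_def by (rule topology_generated_by_Basis) (use a in blast)
    then show "\<exists>T. openin strict_topology T \<and> h \<in> T \<and> T \<subseteq> U"
      using a by (intro exI[of _ "{x. norm ((x - h) \<bullet>\<^sub>C a) < e}"]) (simp add: cb_mult_zero_left)
  qed
qed

lemma topspace_strict [simp]:
  "topspace strict_topology = (UNIV :: ('a::topological_space \<Rightarrow>\<^sub>C complex) set)"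
proof -
  have "openin strict_topology (UNIV :: ('a \<Rightarrow>\<^sub>C complex) set)"
    unfolding openin_strict_iff using C0_0 zero_less_one by blast
  then show ?thesis using openin_subset by blast
qed

lemma openin_strict_nbhd:
  assumes "a \<in> C0"
  shows "openin strict_topology {x. norm ((x - h) \<bullet>\<^sub>C a) < e}"
proof (cases "e > 0")
  case True
  then show ?thesis
    unfolding strict_topology_def by (intro topology_generated_by_Basis) (use assms in blast)
next
  case False
  then have "\<not> norm f < e" for f :: "'a \<Rightarrow>\<^sub>C complex"
    using norm_ge_zero[of f] by linarith
  then have "{x. norm ((x - h) \<bullet>\<^sub>C a) < e} = {}" by blast
  then show ?thesis by simp
qed

lemma in_closure_strict_iff:
  "h \<in> strict_topology closure_of X \<longleftrightarrow> (\<forall>a\<in>C0. \<forall>e>0. \<exists>x\<in>X. norm ((x - h) \<bullet>\<^sub>C a) < e)"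
    (is "?L \<longleftrightarrow> ?R")
proof
  show ?R if ?L
  proof (intro ballI allI impI)
    fix a :: "'a \<Rightarrow>\<^sub>C complex" and e :: real assume a: "a \<in> C0" "e > 0"
    have "h \<in> {x. norm ((x - h) \<bullet>\<^sub>C a) < e}" using a by (simp add: cb_mult_zero_left)
    then have "\<exists>x\<in>X. x \<in> {x. norm ((x - h) \<bullet>\<^sub>C a) < e}"
      using \<open>?L\<close> openin_strict_nbhd[OF a(1), of h e] unfolding in_closure_of by metis
    then show "\<exists>x\<in>X. norm ((x - h) \<bullet>\<^sub>C a) < e" by simp
  qed
  show ?L if ?R
    unfolding in_closure_of
  proof (intro conjI allI impI)
    fix T assume T: "h \<in> T \<and> openin strict_topology T"
    then obtain a e where "a \<in> C0" "e > 0" "{x. norm ((x - h) \<bullet>\<^sub>C a) < e} \<subseteq> T"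
      unfolding openin_strict_iff by meson
    then show "\<exists>y. y \<in> X \<and> y \<in> T"
      using that by (metis (mono_tags, lifting) mem_Collect_eq subsetD)
  qed simp
qed

lemma strictly_dense_iff:
  "strictly_dense X \<longleftrightarrow> (\<forall>h. \<forall>a\<in>C0. \<forall>e>0. \<exists>x\<in>X. norm ((x - h) \<bullet>\<^sub>C a) < e)"
  unfolding strictly_dense_def set_eq_iff in_closure_strict_iff by simp

lemma Hausdorff_strict:
  assumes lc: "locally_compact_space (euclidean :: 'a::t2_space topology)"
  shows "Hausdorff_space (strict_topology :: ('a \<Rightarrow>\<^sub>C complex) topology)"
  unfolding Hausdorff_space_def
proof (intro allI impI)
  fix h k :: "'a \<Rightarrow>\<^sub>C complex"
  assume "h \<in> topspace strict_topology \<and> k \<in> topspace strict_topology \<and> h \<noteq> k"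
  then obtain x where x: "h x \<noteq> k x" using bcontfun_eqI by metis
  obtain a where a: "a \<in> C0" "a x = 1" using C0_nonvanishing[OF lc] by blast
  define e where "e = norm (h x - k x) / 2"
  have e: "e > 0" using x by (simp add: e_def)
  have dist: "norm (f x - g x) < e" if "norm ((f - g) \<bullet>\<^sub>C a) < e" for f g
    using norm_bounded[of "(f - g) \<bullet>\<^sub>C a" x] that a(2) by simp
  have "disjnt {f. norm ((f - h) \<bullet>\<^sub>C a) < e} {f. norm ((f - k) \<bullet>\<^sub>C a) < e}"
  proof -
    have False if "norm ((f - h) \<bullet>\<^sub>C a) < e" "norm ((f - k) \<bullet>\<^sub>C a) < e" for f
      using dist[OF that(1)] dist[OF that(2)] norm_triangle_ineq4[of "f x - k x" "f x - h x"]
      by (simp add: e_def)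
    then show ?thesis unfolding disjnt_def by blast
  qed
  then show "\<exists>U V. openin strict_topology U \<and> openin strict_topology V \<and> h \<in> U \<and> k \<in> V \<and> disjnt U V"
    using openin_strict_nbhd[OF a(1)] e
    by (intro exI[of _ "{f. norm ((f - h) \<bullet>\<^sub>C a) < e}"] exI[of _ "{f. norm ((f - k) \<bullet>\<^sub>C a) < e}"])
      (auto simp: cb_mult_zero_left)
qed

lemma strictly_continuous_linear:
  fixes T :: "('a::topological_space \<Rightarrow>\<^sub>C complex) \<Rightarrow> ('b::topological_space \<Rightarrow>\<^sub>C complex)"
  assumes lin: "Vector_Spaces.linear cb_scale cb_scale T"
    and bd: "\<And>c. c \<in> C0 \<Longrightarrow> \<exists>d\<in>C0. \<exists>C. \<forall>F. norm (T F \<bullet>\<^sub>C c) \<le> C * norm (F \<bullet>\<^sub>C d)"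
  shows "continuous_map strict_topology strict_topology T"
  unfolding continuous_map_def
proof (intro conjI allI impI)
  fix U :: "('b \<Rightarrow>\<^sub>C complex) set" assume U: "openin strict_topology U"
  interpret lin: Vector_Spaces.linear cb_scale cb_scale T by fact
  show "openin strict_topology {x \<in> topspace strict_topology. T x \<in> U}"
    unfolding openin_strict_iff
  proof (clarsimp)
    fix h assume "T h \<in> U"
    then obtain a e where a: "a \<in> C0" "e > 0" "{x. norm ((x - T h) \<bullet>\<^sub>C a) < e} \<subseteq> U"
      using U openin_strict_iff by metis
    obtain d C where d: "d \<in> C0" and C: "\<And>F. norm (T F \<bullet>\<^sub>C a) \<le> C * norm (F \<bullet>\<^sub>C d)"
      using bd[OF a(1)] by blast
    have "T x \<in> U" if "norm ((x - h) \<bullet>\<^sub>C d) < e / (\<bar>C\<bar> + 1)" for x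
    proof -
      have "norm ((T x - T h) \<bullet>\<^sub>C a) \<le> (\<bar>C\<bar> + 1) * norm ((x - h) \<bullet>\<^sub>C d)"
      proof -
        have "C * norm ((x - h) \<bullet>\<^sub>C d) \<le> (\<bar>C\<bar> + 1) * norm ((x - h) \<bullet>\<^sub>C d)"
          by (intro mult_right_mono norm_ge_zero) linarith
        then show ?thesis using C[of "x - h"] by (simp add: lin.diff)
      qed
      also have "\<dots> < (\<bar>C\<bar> + 1) * (e / (\<bar>C\<bar> + 1))" using that by (intro mult_strict_left_mono) auto
      also have "\<dots> = e" by (simp add: field_simps)
      finally show ?thesis using a by blast
    qed
    then show "\<exists>a\<in>C0. \<exists>e>0. {x. norm ((x - h) \<bullet>\<^sub>C a) < e} \<subseteq> {x. T x \<in> U}"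
      using a(2) by (intro bexI[OF _ d] exI[of _ "e / (\<bar>C\<bar> + 1)"] conjI subsetI) simp_all
  qed
qed auto


section \<open>A strict Stone--Weierstrass theorem\<close>

text \<open>
  The algebra may lack the constants, as the functions vanishing at infinity on a noncompact space do;
  that no point is a common zero takes their place.
\<close>

locale separating_function_algebra =
  fixes A :: "('a::t2_space \<Rightarrow> real) set"
  assumes cont: "f \<in> A \<Longrightarrow> continuous_on UNIV f"
    and bdd: "f \<in> A \<Longrightarrow> \<exists>B. \<forall>x. \<bar>f x\<bar> \<le> B"
    and add: "f \<in> A \<Longrightarrow> g \<in> A \<Longrightarrow> (\<lambda>x. f x + g x) \<in> A"
    and mult: "f \<in> A \<Longrightarrow> g \<in> A \<Longrightarrow> (\<lambda>x. f x * g x) \<in> A"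
    and cmult: "f \<in> A \<Longrightarrow> (\<lambda>x. c * f x) \<in> A"
    and sep: "x \<noteq> y \<Longrightarrow> \<exists>f\<in>A. f x \<noteq> f y"
    and nz: "\<exists>f\<in>A. f x \<noteq> 0"
begin

lemma zero: "(\<lambda>x. 0) \<in> A"
proof -
  obtain f where "f \<in> A" using nz by blast
  then show ?thesis using cmult[of f 0] by simp
qed

text \<open>
  Without constants an algebra is closed only under polynomials with vanishing constant term.
\<close>

lemma polynomial_minus_const:
  fixes p :: "real \<Rightarrow> real"
  assumes "v \<in> A" "real_polynomial_function p"
  shows "(\<lambda>x. p (v x) - p 0) \<in> A"
  using assms(2)
proof induction
  case (linear p)
  then have "p t = p 1 * t" for t
    using linear_cmul[OF bounded_linear.linear[OF linear], of t 1] by simp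
  then have "(\<lambda>x. p (v x) - p 0) = (\<lambda>x. p 1 * v x)" by (metis diff_zero mult_zero_right)
  then show ?case using cmult[OF \<open>v \<in> A\<close>] by metis
next
  case (const c)
  show ?case using cmult[OF \<open>v \<in> A\<close>, of 0] by simp
next
  case (add p q)
  note IH = add.IH
  have "(\<lambda>x. p (v x) + q (v x) - (p 0 + q 0)) = (\<lambda>x. (p (v x) - p 0) + (q (v x) - q 0))" by auto
  then show ?case using separating_function_algebra.add[OF separating_function_algebra_axioms IH] by simp
next
  case (mult p q)
  note IH = mult.IH
  have "(\<lambda>x. p (v x) * q (v x) - p 0 * q 0) =
    (\<lambda>x. ((p (v x) - p 0) * (q (v x) - q 0) + p 0 * (q (v x) - q 0)) + q 0 * (p (v x) - p 0))"
    by (auto simp: algebra_simps)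
  moreover have "\<dots> \<in> A"
    by (intro separating_function_algebra.add[OF separating_function_algebra_axioms]
        separating_function_algebra.mult[OF separating_function_algebra_axioms] cmult IH)
  ultimately show ?case by simp
qed

text \<open>
  By compactness a finite sum \<open>g\<close> of squares of members is bounded below on \<open>K\<close> by a positive number.
  Scaled to \<open>0 < g/B \<le> 1\<close> on \<open>K\<close>, it yields \<open>1 - (1 - g/B) ^ n\<close>, which tends to \<open>1\<close> uniformly on \<open>K\<close>
  and is a polynomial in \<open>g\<close> without constant term.
\<close>

lemma approximate_unit_on_compact:
  assumes K: "compact K" and d: "d > 0"
  obtains u where "u \<in> A" "\<And>x. x \<in> K \<Longrightarrow> \<bar>u x - 1\<bar> < d"
proof (cases "K = {}")
  case True
  then show ?thesis using nz that by blast
next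
  case False
  obtain F where F: "\<And>x. F x \<in> A" "\<And>x. F x x \<noteq> 0" using nz by metis
  have "open {y. F x y \<noteq> 0}" for x
  proof -
    have "open (F x -` (- {0}))"
      using cont[OF F(1), of x] by (intro open_vimage) auto
    then show ?thesis by (simp add: vimage_def)
  qed
  moreover have "K \<subseteq> (\<Union>x\<in>K. {y. F x y \<noteq> 0})" using F(2) by blast
  ultimately obtain D where D: "D \<subseteq> K" "finite D" "K \<subseteq> (\<Union>x\<in>D. {y. F x y \<noteq> 0})"
    using compactE_image[OF K, of K "\<lambda>x. {y. F x y \<noteq> 0}"] by metis
  define g where "g = (\<lambda>y. \<Sum>x\<in>D. F x y * F x y)"
  have gA: "g \<in> A"
    unfolding g_def using D(2)
    by (induction D rule: finite_induct) (auto intro: zero add[OF mult[OF F(1) F(1)]])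
  have gpos: "g y > 0" if y: "y \<in> K" for y
  proof -
    obtain x where "x \<in> D" "F x y \<noteq> 0" using D(3) y by blast
    then show ?thesis unfolding g_def
      by (intro sum_pos2[OF D(2)]) (auto simp: zero_less_mult_iff linorder_neq_iff)
  qed
  have cg: "continuous_on K g" using cont[OF gA] continuous_on_subset by blast
  obtain y0 where y0: "y0 \<in> K" "\<And>y. y \<in> K \<Longrightarrow> g y0 \<le> g y"
    using continuous_attains_inf[OF K False cg] by blast
  obtain y1 where y1: "y1 \<in> K" "\<And>y. y \<in> K \<Longrightarrow> g y \<le> g y1"
    using continuous_attains_sup[OF K False cg] by blast
  let ?B = "g y1"
  have B: "?B > 0" using gpos y1(1) by blast
  define u where "u n = (\<lambda>y. 1 - (1 - g y / ?B) ^ n)" for n :: nat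
  have uA: "u n \<in> A" for n
  proof (induction n)
    case 0
    show ?case using zero by (simp add: u_def)
  next
    case (Suc n)
    have gB: "(\<lambda>y. inverse ?B * g y) \<in> A" using cmult[OF gA] .
    have "u (Suc n) = (\<lambda>y. u n y + (inverse ?B * g y + (-1) * (inverse ?B * g y * u n y)))"
      by (auto simp: u_def divide_inverse algebra_simps)
    moreover have "\<dots> \<in> A"
      by (intro add[OF Suc] add[OF gB] cmult[of _ "-1"] mult[OF gB Suc])
    ultimately show ?case by simp
  qed
  define q where "q = 1 - g y0 / ?B"
  have q: "0 \<le> q" "q < 1"
    using y1(2)[OF y0(1)] gpos[OF y0(1)] B by (auto simp: q_def field_simps)
  obtain n where n: "q ^ n < d" using real_arch_pow_inv[OF d q(2)] by blast
  have "\<bar>u n y - 1\<bar> < d" if y: "y \<in> K" for y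
  proof -
    have "0 \<le> 1 - g y / ?B" "1 - g y / ?B \<le> q"
      using y0(2)[OF y] y1(2)[OF y] B by (auto simp: q_def field_simps)
    then have "(1 - g y / ?B) ^ n \<le> q ^ n" "0 \<le> (1 - g y / ?B) ^ n" by (auto intro: power_mono)
    then show ?thesis using n by (simp add: u_def)
  qed
  then show ?thesis using that uA by blast
qed

text \<open>
  The bound on \<open>w\<close> away from \<open>K\<close>, independent of \<open>K\<close>, is the point: an approximant of \<open>h\<close> on \<open>K\<close> may
  be arbitrarily large elsewhere, and then is useless for the strict topology. The classical theorem
  on \<open>K\<close>, for the algebra enlarged by the constants, gives an approximant \<open>f + c\<close>; multiplying it by
  an approximate unit for \<open>K\<close> brings it back into the algebra. The result is then truncated at height
  \<open>M + e/2\<close>, the truncation being replaced by a polynomial close to it on the range of the function.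
\<close>

lemma bounded_Stone_Weierstrass:
  assumes K: "compact K" and h: "continuous_on UNIV h" "\<And>x. \<bar>h x\<bar> \<le> M" and e: "e > 0"
  obtains w where "w \<in> A" "\<And>x. x \<in> K \<Longrightarrow> \<bar>w x - h x\<bar> < e" "\<And>x. \<bar>w x\<bar> \<le> M + e"
proof -
  have M: "0 \<le> M" using h(2)[of undefined] by linarith
  define R where "R = {(\<lambda>x. f x + c) | f c. f \<in> A}"
  have contR: "continuous_on UNIV f" if "f \<in> R" for f
    using that cont by (auto simp: R_def intro!: continuous_intros)
  interpret R: function_ring_on R K
  proof
    show "compact K" by fact
    show "continuous_on K f" if "f \<in> R" for f
      using contR[OF that] continuous_on_subset by blast
    show "(\<lambda>x. f x + g x) \<in> R" if fg: "f \<in> R" "g \<in> R" for f g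
    proof -
      obtain f' g' c d where "f = (\<lambda>x. f' x + c)" "g = (\<lambda>x. g' x + d)" "f' \<in> A" "g' \<in> A"
        using fg by (auto simp: R_def)
      then show ?thesis unfolding R_def
        by (intro CollectI exI[of _ "\<lambda>x. f' x + g' x"] exI[of _ "c + d"]) (auto intro: add)
    qed
    show "(\<lambda>x. f x * g x) \<in> R" if fg: "f \<in> R" "g \<in> R" for f g
    proof -
      obtain f' g' c d where "f = (\<lambda>x. f' x + c)" "g = (\<lambda>x. g' x + d)" "f' \<in> A" "g' \<in> A"
        using fg by (auto simp: R_def)
      moreover from this have "(\<lambda>x. (f' x * g' x + c * g' x) + d * f' x) \<in> A"
        by (intro add mult cmult)
      moreover have "(\<lambda>x. f x * g x) = (\<lambda>x. ((f' x * g' x + c * g' x) + d * f' x) + c * d)"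
        using calculation by (simp add: algebra_simps)
      ultimately show ?thesis unfolding R_def
        by (intro CollectI exI[of _ "\<lambda>x. (f' x * g' x + c * g' x) + d * f' x"] exI[of _ "c * d"] conjI)
    qed
    show "(\<lambda>_. c) \<in> R" for c
      unfolding R_def using zero by (intro CollectI exI[of _ "\<lambda>x. 0"] exI[of _ c]) auto
    show "\<exists>f\<in>R. f x \<noteq> f y" if "x \<noteq> y" for x y
    proof -
      obtain f where f: "f \<in> A" "f x \<noteq> f y" using sep[OF \<open>x \<noteq> y\<close>] by blast
      then have "(\<lambda>x. f x + 0) \<in> R" unfolding R_def by blast
      then show ?thesis using f(2) by (intro bexI[of _ "\<lambda>x. f x + 0"]) auto
    qed
  qed
  have hK: "continuous_on K h" using h(1) continuous_on_subset by blast
  obtain G where G: "G \<in> R" "\<And>x. x \<in> K \<Longrightarrow> \<bar>h x - G x\<bar> < e/4"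
    using R.Stone_Weierstrass_basic[OF hK, of "e/4"] e by auto
  obtain f c where f: "f \<in> A" "G = (\<lambda>x. f x + c)" using G(1) by (auto simp: R_def)
  obtain B where B: "\<And>x. \<bar>f x\<bar> \<le> B" using bdd[OF f(1)] by blast
  have GB: "\<bar>G x\<bar> \<le> \<bar>B\<bar> + \<bar>c\<bar> + 1" for x using B[of x] by (simp add: f(2))
  let ?D = "\<bar>B\<bar> + \<bar>c\<bar> + 1"
  have D: "?D > 0" by linarith
  have "e / (4 * ?D) > 0" using e D by (intro divide_pos_pos) auto
  then obtain u where u: "u \<in> A" "\<And>x. x \<in> K \<Longrightarrow> \<bar>u x - 1\<bar> < e / (4 * ?D)"
    by (rule approximate_unit_on_compact[OF K]) (rule that)
  define v where "v = (\<lambda>x. f x * u x + c * u x)"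
  have v: "v \<in> A" unfolding v_def by (intro add mult cmult f u)
  have vh: "\<bar>v x - h x\<bar> < e/2" if x: "x \<in> K" for x
  proof -
    have "\<bar>G x * (u x - 1)\<bar> \<le> ?D * (e / (4 * ?D))"
      unfolding abs_mult using u(2)[OF x] GB[of x] D by (intro mult_mono) auto
    also have "\<dots> = e/4" using D by (simp add: field_simps)
    finally have "\<bar>G x * (u x - 1)\<bar> \<le> e/4" .
    moreover have "v x - h x = G x * (u x - 1) + (G x - h x)" by (simp add: v_def f(2) algebra_simps)
    ultimately show ?thesis using G(2)[OF x] by linarith
  qed
  obtain V where V: "\<And>x. \<bar>v x\<bar> \<le> V" using bdd[OF v] by blast
  let ?N = "M + e/2"
  define clamp where "clamp = (\<lambda>t::real. max (- ?N) (min ?N t))"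
  have "continuous_on {- \<bar>V\<bar>..\<bar>V\<bar>} clamp"
    unfolding clamp_def by (intro continuous_intros)
  then obtain p where p: "real_polynomial_function p"
    "\<And>t. t \<in> {- \<bar>V\<bar>..\<bar>V\<bar>} \<Longrightarrow> \<bar>clamp t - p t\<bar> < e/8"
    using Stone_Weierstrass_real_polynomial_function[of "{- \<bar>V\<bar>..\<bar>V\<bar>}" clamp "e/8"] e by auto
  define w where "w = (\<lambda>x. p (v x) - p 0)"
  have wA: "w \<in> A"
    unfolding w_def by (rule polynomial_minus_const[OF v p(1)])
  have p0: "\<bar>p 0\<bar> < e/8"
    using p(2)[of 0] M e by (simp add: clamp_def)
  have wc: "\<bar>w x - clamp (v x)\<bar> < e/4" for x
  proof -
    have "v x \<in> {- \<bar>V\<bar>..\<bar>V\<bar>}" using V[of x] by auto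
    from p(2)[OF this] p0 show ?thesis unfolding w_def by linarith
  qed
  show thesis
  proof (rule that[OF wA])
    show "\<bar>w x - h x\<bar> < e" if x: "x \<in> K" for x
    proof -
      have "\<bar>v x\<bar> \<le> ?N" using vh[OF x] h(2)[of x] by linarith
      then have "clamp (v x) = v x" unfolding abs_le_iff clamp_def by linarith
      then show ?thesis using wc[of x] vh[OF x] e by linarith
    qed
    show "\<bar>w x\<bar> \<le> M + e" for x
    proof -
      have "- ?N \<le> clamp (v x)" by (simp add: clamp_def)
      moreover have "clamp (v x) \<le> ?N"
        unfolding clamp_def by (intro max.boundedI min.cobounded1) (use M e in linarith)
      ultimately have "\<bar>clamp (v x)\<bar> \<le> ?N" by linarith
      then show ?thesis using wc[of x] e by linarith
    qed
  qed
qed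

end

text \<open>
  Given \<open>a\<close> vanishing at infinity, approximate \<open>h\<close> on a compact set off which \<open>a\<close> is small, by
  functions whose sup norm is controlled by that of \<open>h\<close>. The hypothesis on conjugates allows real and
  imaginary parts to be treated separately.
\<close>

theorem strict_Stone_Weierstrass:
  fixes G :: "('a::t2_space \<Rightarrow>\<^sub>C complex) set"
  assumes mult: "\<And>f g. f \<in> G \<Longrightarrow> g \<in> G \<Longrightarrow> f \<bullet>\<^sub>C g \<in> G"
    and cnj: "\<And>f. f \<in> G \<Longrightarrow> cb_cnj f \<in> G"
    and sep: "\<And>x y. x \<noteq> y \<Longrightarrow> \<exists>f\<in>G. f x \<noteq> f y"
    and nz: "\<And>x. \<exists>f\<in>G. f x \<noteq> 0"
  shows "strictly_dense (cb.span G)"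
proof -
  have span_mult1: "f \<bullet>\<^sub>C g \<in> cb.span G" if "f \<in> G" "g \<in> cb.span G" for f g
    using that(2)
  proof (induction rule: cb.span_induct_alt)
    case base
    show ?case by (simp add: cb_mult_commute[of _ 0] cb_mult_zero_left cb.span_zero)
  next
    case (step c k g)
    have "f \<bullet>\<^sub>C (cb_scale c k + g) = cb_scale c (f \<bullet>\<^sub>C k) + f \<bullet>\<^sub>C g"
      by (rule bcontfun_eqI) (simp add: algebra_simps)
    then show ?case
      using step mult[OF that(1)] by (auto intro: cb.span_add cb.span_scale cb.span_base)
  qed
  have span_mult: "f \<bullet>\<^sub>C g \<in> cb.span G" if "f \<in> cb.span G" "g \<in> cb.span G" for f g
    using that(1)
  proof (induction rule: cb.span_induct_alt)
    case base
    show ?case by (simp add: cb_mult_zero_left cb.span_zero)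
  next
    case (step c k f)
    have "(cb_scale c k + f) \<bullet>\<^sub>C g = cb_scale c (k \<bullet>\<^sub>C g) + f \<bullet>\<^sub>C g"
      by (rule bcontfun_eqI) (simp add: algebra_simps)
    then show ?case
      using step span_mult1[OF _ that(2)] by (auto intro: cb.span_add cb.span_scale)
  qed
  have span_cnj: "cb_cnj f \<in> cb.span G" if "f \<in> cb.span G" for f
    using that
  proof (induction rule: cb.span_induct_alt)
    case base
    have "cb_cnj 0 = (0 :: 'a \<Rightarrow>\<^sub>C complex)" by (rule bcontfun_eqI) simp
    then show ?case by (simp add: cb.span_zero)
  next
    case (step c k f)
    have "cb_cnj (cb_scale c k + f) = cb_scale (cnj c) (cb_cnj k) + cb_cnj f"
      by (rule bcontfun_eqI) simp
    then show ?case
      using step cnj by (auto intro: cb.span_add cb.span_scale cb.span_base)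
  qed
  define A where "A = {g :: 'a \<Rightarrow> real. \<exists>f\<in>cb.span G. \<forall>x. f x = complex_of_real (g x)}"
  have A_Re: "(\<lambda>x. Re (f x)) \<in> A" and A_Im: "(\<lambda>x. Im (f x)) \<in> A" if "f \<in> cb.span G" for f
  proof -
    have "cb_scale (1/2) (f + cb_cnj f) \<in> cb.span G"
      using that span_cnj by (intro cb.span_scale cb.span_add) auto
    moreover have "cb_scale (1/2) (f + cb_cnj f) x = complex_of_real (Re (f x))" for x
      by (simp add: complex_add_cnj)
    ultimately show "(\<lambda>x. Re (f x)) \<in> A" unfolding A_def by blast
    have "cb_scale (- \<i>/2) (f - cb_cnj f) \<in> cb.span G"
      using that span_cnj by (intro cb.span_scale cb.span_diff) auto
    moreover have "cb_scale (- \<i>/2) (f - cb_cnj f) x = complex_of_real (Im (f x))" for x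
      by (simp add: complex_eq_iff)
    ultimately show "(\<lambda>x. Im (f x)) \<in> A" unfolding A_def by blast
  qed
  have A_cont: "continuous_on UNIV g" and A_bdd: "\<exists>B. \<forall>x. \<bar>g x\<bar> \<le> B" if "g \<in> A" for g
  proof -
    obtain f where "f \<in> cb.span G" "\<And>x. f x = complex_of_real (g x)"
      using \<open>g \<in> A\<close> by (auto simp: A_def)
    then have g: "g = (\<lambda>x. Re (f x))" by auto
    show "continuous_on UNIV g" unfolding g by (intro continuous_intros) auto
    show "\<exists>B. \<forall>x. \<bar>g x\<bar> \<le> B"
      unfolding g by (intro exI[of _ "norm f"] allI) (meson abs_Re_le_cmod norm_bounded order_trans)
  qed
  have A_add: "(\<lambda>x. f x + g x) \<in> A" and A_mult: "(\<lambda>x. f x * g x) \<in> A" if fg: "f \<in> A" "g \<in> A" for f g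
  proof -
    obtain f' g' where *: "f' \<in> cb.span G" "\<And>x. f' x = complex_of_real (f x)"
      "g' \<in> cb.span G" "\<And>x. g' x = complex_of_real (g x)"
      using fg by (auto simp: A_def)
    show "(\<lambda>x. f x + g x) \<in> A"
      unfolding A_def by (intro CollectI bexI[of _ "f' + g'"]) (auto simp: * cb.span_add)
    show "(\<lambda>x. f x * g x) \<in> A"
      unfolding A_def by (intro CollectI bexI[of _ "f' \<bullet>\<^sub>C g'"]) (auto simp: * span_mult)
  qed
  have A_cmult: "(\<lambda>x. c * f x) \<in> A" if "f \<in> A" for f c
  proof -
    obtain f' where *: "f' \<in> cb.span G" "\<And>x. f' x = complex_of_real (f x)"
      using \<open>f \<in> A\<close> by (auto simp: A_def)
    show ?thesis
      unfolding A_def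
      by (intro CollectI bexI[of _ "cb_scale (complex_of_real c) f'"]) (auto simp: * cb.span_scale)
  qed
  have A_sep: "\<exists>f\<in>A. f x \<noteq> f y" if xy: "x \<noteq> y" for x y
  proof -
    obtain f where f: "f \<in> G" "f x \<noteq> f y" using sep[OF xy] by blast
    then have "Re (f x) \<noteq> Re (f y) \<or> Im (f x) \<noteq> Im (f y)" by (simp add: complex_eq_iff)
    then show ?thesis
      by (elim disjE)
        (rule bexI[OF _ A_Re[OF cb.span_base[OF f(1)]]] bexI[OF _ A_Im[OF cb.span_base[OF f(1)]]]; assumption)+
  qed
  have A_nz: "\<exists>f\<in>A. f x \<noteq> 0" for x
  proof -
    obtain f where f: "f \<in> G" "f x \<noteq> 0" using nz by blast
    then have "Re (f x) \<noteq> 0 \<or> Im (f x) \<noteq> 0" by (simp add: complex_eq_iff)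
    then show ?thesis
      by (elim disjE)
        (rule bexI[OF _ A_Re[OF cb.span_base[OF f(1)]]] bexI[OF _ A_Im[OF cb.span_base[OF f(1)]]]; assumption)+
  qed
  interpret A: separating_function_algebra A
    by unfold_locales (fact A_cont A_bdd A_add A_mult A_cmult A_sep A_nz)+
  show ?thesis
    unfolding strictly_dense_iff
  proof (intro allI ballI impI)
    fix h a :: "'a \<Rightarrow>\<^sub>C complex" and e :: real
    assume a: "a \<in> C0" and e: "e > 0"
    let ?M = "norm h"
    \<comment> \<open>\<open>|f - h|\<close> will be at most \<open>2 \<eta>\<close> on \<open>K\<close>, and at most \<open>2 (2 \<parallel>h\<parallel> + \<eta>) \<le> 4 \<parallel>h\<parallel> + 2\<close> off \<open>K\<close>\<close>
    define \<eta> where "\<eta> = min 1 (e / (4 * (norm a + 1)))"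
    have eta: "\<eta> > 0" "\<eta> \<le> 1" "2 * \<eta> * norm a \<le> e / 2"
    proof -
      have na: "norm a + 1 > 0" using norm_ge_zero[of a] by linarith
      then show "\<eta> > 0" "\<eta> \<le> 1" using e by (auto simp: \<eta>_def)
      have "2 * \<eta> * norm a \<le> 2 * (e / (4 * (norm a + 1))) * (norm a + 1)"
        using e na by (intro mult_mono) (auto simp: \<eta>_def)
      also have "\<dots> = e / 2" using na by (simp add: field_simps)
      finally show "2 * \<eta> * norm a \<le> e / 2" .
    qed
    have M: "4 * ?M + 2 > 0" using norm_ge_zero[of h] by linarith
    then have "e / (2 * (4 * ?M + 2)) > 0" using e by simp
    then obtain K where K: "compact K" "\<And>x. x \<notin> K \<Longrightarrow> norm (a x) < e / (2 * (4 * ?M + 2))"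
      using a unfolding C0_def by blast
    have cR: "continuous_on UNIV (\<lambda>x. Re (h x))" "continuous_on UNIV (\<lambda>x. Im (h x))"
      by (intro continuous_intros; simp)+
    have bR: "\<bar>Re (h x)\<bar> \<le> ?M" "\<bar>Im (h x)\<bar> \<le> ?M" for x
      using abs_Re_le_cmod[of "h x"] abs_Im_le_cmod[of "h x"] norm_bounded[of h x] by linarith+
    obtain r where r: "r \<in> A" "\<And>x. x \<in> K \<Longrightarrow> \<bar>r x - Re (h x)\<bar> < \<eta>" "\<And>x. \<bar>r x\<bar> \<le> ?M + \<eta>"
      by (rule A.bounded_Stone_Weierstrass[OF K(1) cR(1) bR(1) eta(1)]) (rule that)
    obtain s where s: "s \<in> A" "\<And>x. x \<in> K \<Longrightarrow> \<bar>s x - Im (h x)\<bar> < \<eta>" "\<And>x. \<bar>s x\<bar> \<le> ?M + \<eta>"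
      by (rule A.bounded_Stone_Weierstrass[OF K(1) cR(2) bR(2) eta(1)]) (rule that)
    obtain r' s' where r': "r' \<in> cb.span G" "\<And>x. r' x = complex_of_real (r x)"
      and s': "s' \<in> cb.span G" "\<And>x. s' x = complex_of_real (s x)"
      using r(1) s(1) by (auto simp: A_def)
    define f where "f = r' + cb_scale \<i> s'"
    have fh: "norm (f x - h x) \<le> \<bar>r x - Re (h x)\<bar> + \<bar>s x - Im (h x)\<bar>" for x
      using cmod_le[of "f x - h x"] by (simp add: f_def r' s')
    have "norm (((f - h) \<bullet>\<^sub>C a) x) \<le> e / 2" for x
    proof (cases "x \<in> K")
      case True
      then have "norm (f x - h x) \<le> 2 * \<eta>" using fh[of x] r(2)[of x] s(2)[of x] by linarith
      then have "norm (f x - h x) * norm (a x) \<le> 2 * \<eta> * norm a"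
        using eta by (intro mult_mono norm_bounded) auto
      then show ?thesis using eta(3) by (simp add: norm_mult)
    next
      case False
      have "norm (f x - h x) \<le> 4 * ?M + 2"
        using fh[of x] r(3)[of x] s(3)[of x] bR[of x] eta(2) by linarith
      then have "norm (f x - h x) * norm (a x) \<le> (4 * ?M + 2) * (e / (2 * (4 * ?M + 2)))"
        using K(2)[OF False] M by (intro mult_mono) auto
      also have "\<dots> = e / 2" using M by (simp add: field_simps)
      finally show ?thesis by (simp add: norm_mult)
    qed
    then have "norm ((f - h) \<bullet>\<^sub>C a) \<le> e / 2" by (rule norm_bound)
    then have "norm ((f - h) \<bullet>\<^sub>C a) < e" using e by linarith
    moreover have "f \<in> cb.span G"
      unfolding f_def using r' s' by (intro cb.span_add cb.span_scale)
    ultimately show "\<exists>x\<in>cb.span G. norm ((x - h) \<bullet>\<^sub>C a) < e" by blast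
  qed
qed


section \<open>Functionals on functions vanishing at infinity\<close>

lemma C0_dual_add: "\<mu> \<in> C0_dual \<Longrightarrow> f \<in> C0 \<Longrightarrow> g \<in> C0 \<Longrightarrow> \<mu> (f + g) = \<mu> f + \<mu> g"
  and C0_dual_scale: "\<mu> \<in> C0_dual \<Longrightarrow> f \<in> C0 \<Longrightarrow> \<mu> (cb_scale c f) = c * \<mu> f"
  unfolding C0_dual_def by auto

lemma C0_dual_diff:
  assumes "\<mu> \<in> C0_dual" "f \<in> C0" "g \<in> C0" shows "\<mu> (f - g) = \<mu> f - \<mu> g"
  using C0_dual_add[OF assms(1) C0_diff[OF assms(2,3)] assms(3)] by simp

lemma C0_dual_bound:
  assumes "\<mu> \<in> C0_dual"
  obtains B where "B \<ge> 0" "\<And>f. f \<in> C0 \<Longrightarrow> norm (\<mu> f) \<le> B * norm f"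
proof -
  obtain B where B: "\<And>f. f \<in> C0 \<Longrightarrow> norm (\<mu> f) \<le> B * norm f"
    using assms unfolding C0_dual_def by blast
  have "norm (\<mu> f) \<le> \<bar>B\<bar> * norm f" if "f \<in> C0" for f
    using B[OF that] mult_right_mono[of B "\<bar>B\<bar>" "norm f"] by fastforce
  then show thesis using that[of "\<bar>B\<bar>"] by simp
qed

lemma unimodular_rotation: "\<exists>c. norm c = 1 \<and> c * z = complex_of_real (norm z)"
proof (cases "z = 0")
  case True
  then show ?thesis by (intro exI[of _ 1]) simp
next
  case False
  have "cnj z * z = complex_of_real (norm z) * complex_of_real (norm z)"
    using complex_norm_square[of z] by (simp add: power2_eq_square mult.commute)
  then have "cnj z / complex_of_real (norm z) * z = complex_of_real (norm z)"
    using False by simp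
  moreover have "norm (cnj z / complex_of_real (norm z)) = 1" using False by (simp add: norm_divide)
  ultimately show ?thesis by blast
qed

text \<open>
  Let \<open>f\<close> in the unit ball nearly attain
  the norm \<open>M\<close> of \<open>\<mu>\<close>, and let \<open>\<phi> = min 1 (|f|/\<delta>)\<close>. Then \<open>f\<close> and \<open>h (1 - \<phi>)\<close> have almost disjoint
  supports: their sum, after multiplication of each by a scalar of modulus one, has norm at most
  \<open>1 + \<delta>\<close> if \<open>\<parallel>h\<parallel> \<le> 1\<close>. Hence \<open>|\<mu> f| + |\<mu> (h (1 - \<phi>))| \<le> M (1 + \<delta>)\<close>, and little is left for the
  second summand.
\<close>

lemma C0_dual_tight:
  fixes \<mu> :: "('a::topological_space \<Rightarrow>\<^sub>C complex) \<Rightarrow> complex"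
  assumes mu: "\<mu> \<in> C0_dual" and eps: "\<epsilon> > 0"
  obtains \<phi> p where "\<phi> \<in> C0" "\<And>x. \<phi> x = complex_of_real (p x)" "\<And>x. 0 \<le> p x" "\<And>x. p x \<le> 1"
    "\<And>h. h \<in> C0 \<Longrightarrow> norm (\<mu> (h - h \<bullet>\<^sub>C \<phi>)) \<le> \<epsilon> * norm h"
proof -
  obtain B where B: "B \<ge> 0" "\<And>f. f \<in> C0 \<Longrightarrow> norm (\<mu> f) \<le> B * norm f"
    using C0_dual_bound[OF mu] by blast
  define S where "S = {norm (\<mu> f) | f. f \<in> C0 \<and> norm f \<le> 1}"
  define M where "M = Sup S"
  have bS: "s \<le> B" if s: "s \<in> S" for s
  proof -
    obtain f where "s = norm (\<mu> f)" "f \<in> C0" "norm f \<le> 1" using s by (auto simp: S_def)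
    then show ?thesis using B(2)[of f] mult_left_mono[of "norm f" 1 B] B(1) by simp
  qed
  then have bdd: "bdd_above S" by (rule bdd_aboveI)
  have mu0: "\<mu> 0 = 0" using C0_dual_diff[OF mu C0_0 C0_0] by simp
  have zS: "0 \<in> S" unfolding S_def using mu0 C0_0 by (intro CollectI exI[of _ 0]) simp
  have M0: "0 \<le> M" unfolding M_def by (rule cSup_upper[OF zS bdd])
  \<comment> \<open>an element of \<open>C0\<close> is a multiple of one in the unit ball\<close>
  have normalise: "\<exists>g\<in>C0. norm g \<le> 1 \<and> f = cb_scale (complex_of_real (norm f)) g"
    if "f \<in> C0" for f :: "'a \<Rightarrow>\<^sub>C complex"
  proof (cases "f = 0")
    case True
    then show ?thesis using C0_0 by (intro bexI[of _ 0]) auto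
  next
    case False
    define g where "g = cb_scale (complex_of_real (inverse (norm f))) f"
    have "norm g = 1" unfolding g_def norm_cb_scale using False by (simp add: norm_inverse)
    moreover have "f = cb_scale (complex_of_real (norm f)) g" using False by (simp add: g_def)
    moreover have "g \<in> C0" unfolding g_def using that by (rule C0_scale)
    ultimately show ?thesis by (intro bexI[of _ g]) auto
  qed
  have M: "norm (\<mu> f) \<le> M * norm f" if f: "f \<in> C0" for f
  proof -
    obtain g where g: "g \<in> C0" "norm g \<le> 1" "f = cb_scale (complex_of_real (norm f)) g"
      using normalise[OF f] by blast
    have "norm (\<mu> g) \<in> S" unfolding S_def using g by blast
    then have "norm (\<mu> g) \<le> M" unfolding M_def by (intro cSup_upper bdd)
    have "norm (\<mu> f) = norm f * norm (\<mu> g)"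
      by (subst g(3)) (simp add: C0_dual_scale[OF mu g(1)] norm_mult)
    also have "\<dots> \<le> M * norm f" using mult_left_mono[OF \<open>norm (\<mu> g) \<le> M\<close>, of "norm f"]
      by (simp add: mult.commute)
    finally show ?thesis .
  qed
  \<comment> \<open>the estimate below ends with \<open>M (1 + \<delta>) - (M - \<delta>) = \<delta> (M + 1)\<close>\<close>
  define \<delta> where "\<delta> = \<epsilon> / (M + 1)"
  have delta: "\<delta> > 0" "\<delta> * (M + 1) = \<epsilon>" using eps M0 by (auto simp: \<delta>_def)
  have "M - \<delta> < Sup S" using delta by (simp add: M_def)
  then obtain f where f: "f \<in> C0" "norm f \<le> 1" "norm (\<mu> f) > M - \<delta>"
    using less_cSup_iff[of S "M - \<delta>"] zS bdd unfolding S_def by blast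
  define p where "p = (\<lambda>x. min 1 (norm (f x) / \<delta>))"
  have p: "0 \<le> p x" "p x \<le> 1" for x using delta by (auto simp: p_def)
  define \<phi> where "\<phi> = Bcontfun (\<lambda>x. complex_of_real (p x))"
  have phi: "\<phi> x = complex_of_real (p x)" for x
    unfolding \<phi>_def
  proof (rule apply_Bcontfun[where B = 1])
    show "continuous_on UNIV (\<lambda>x. complex_of_real (p x))"
      unfolding p_def using delta by (intro continuous_intros) auto
    show "norm (complex_of_real (p x)) \<le> 1" for x using p[of x] by (simp add: norm_of_real)
  qed
  have phiC0: "\<phi> \<in> C0"
  proof (rule C0_dominated[OF f(1), where C = "1 / \<delta>"])
    show "norm (\<phi> x) \<le> 1 / \<delta> * norm (f x)" for x
      unfolding phi norm_of_real using p(1)[of x] by (simp add: p_def)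
  qed
  have unit: "norm (\<mu> (h - h \<bullet>\<^sub>C \<phi>)) \<le> \<epsilon>" if h: "h \<in> C0" "norm h \<le> 1" for h
  proof -
    define k where "k = h - h \<bullet>\<^sub>C \<phi>"
    have k: "k \<in> C0" unfolding k_def using h(1) by (intro C0_diff C0_mult_left)
    \<comment> \<open>rotate both values of \<open>\<mu>\<close> to the positive axis, so that their moduli add up\<close>
    obtain c d where c: "norm c = 1" "c * \<mu> f = complex_of_real (norm (\<mu> f))"
      and d: "norm d = 1" "d * \<mu> k = complex_of_real (norm (\<mu> k))"
      using unimodular_rotation by meson
    define g where "g = cb_scale c f + cb_scale d k"
    have gC0: "g \<in> C0" unfolding g_def by (intro C0_add C0_scale f k)
    have "norm (g x) \<le> 1 + \<delta>" for x
    proof -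
      have kx: "k x = h x * complex_of_real (1 - p x)" by (simp add: k_def phi algebra_simps)
      have nk: "norm (k x) = norm (h x) * (1 - p x)"
        unfolding kx norm_mult norm_of_real using p(2)[of x] by simp
      have "norm (g x) \<le> norm (f x) + norm (k x)"
        using norm_triangle_ineq[of "c * f x" "d * k x"] c(1) d(1) by (simp add: g_def norm_mult)
      also have "\<dots> \<le> 1 + \<delta>"
        \<comment> \<open>where \<open>|f| \<ge> \<delta>\<close> the second summand vanishes, elsewhere the first is small\<close>
      proof (cases "norm (f x) \<ge> \<delta>")
        case True
        then have "p x = 1" using delta by (simp add: p_def)
        then have "norm (k x) = 0" using nk by simp
        then show ?thesis using norm_bounded[of f x] f(2) delta by linarith
      next
        case False
        have "norm (h x) * (1 - p x) \<le> 1 * 1"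
          using norm_bounded[of h x] h(2) p[of x] by (intro mult_mono) auto
        then show ?thesis using False nk by linarith
      qed
      finally show ?thesis .
    qed
    then have ng: "norm g \<le> 1 + \<delta>" by (rule norm_bound)
    have "\<mu> g = complex_of_real (norm (\<mu> f) + norm (\<mu> k))"
      unfolding g_def by (simp add: C0_dual_add[OF mu] C0_dual_scale[OF mu] C0_scale f(1) k c d)
    then have "norm (\<mu> f) + norm (\<mu> k) = norm (\<mu> g)" by (simp del: of_real_add add: norm_of_real)
    also have "\<dots> \<le> M * (1 + \<delta>)" using M[OF gC0] mult_left_mono[OF ng M0] by linarith
    finally show ?thesis using f(3) delta(2) unfolding k_def[symmetric] by (simp add: algebra_simps)
  qed
  have "norm (\<mu> (h - h \<bullet>\<^sub>C \<phi>)) \<le> \<epsilon> * norm h" if h: "h \<in> C0" for h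
  proof -
    obtain g where g: "g \<in> C0" "norm g \<le> 1" "h = cb_scale (complex_of_real (norm h)) g"
      using normalise[OF h] by blast
    have "h - h \<bullet>\<^sub>C \<phi> = cb_scale (complex_of_real (norm h)) (g - g \<bullet>\<^sub>C \<phi>)"
      by (subst (1 2) g(3)) (simp add: cb_mult_scale_left cb.scale_right_diff_distrib)
    then have "norm (\<mu> (h - h \<bullet>\<^sub>C \<phi>)) = norm h * norm (\<mu> (g - g \<bullet>\<^sub>C \<phi>))"
      using g(1) by (simp add: C0_dual_scale[OF mu] C0_diff C0_mult_left norm_mult)
    then show ?thesis using mult_left_mono[OF unit[OF g(1,2)], of "norm h"] by (simp add: mult.commute)
  qed
  then show thesis using that phiC0 phi p by blast
qed

lemma C0_uniform_closed:
  fixes g :: "'a::topological_space \<Rightarrow>\<^sub>C complex"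
  assumes "\<And>e. e > 0 \<Longrightarrow> \<exists>f\<in>C0. \<forall>x. norm (g x - f x) < e"
  shows "g \<in> C0"
  unfolding C0_def
proof (intro CollectI allI impI)
  fix e :: real assume "e > 0"
  then have e: "e / 2 > 0" by simp
  obtain f where f: "f \<in> C0" "\<And>x. norm (g x - f x) < e / 2" using assms[OF e] by blast
  obtain K where K: "compact K" "\<And>x. x \<notin> K \<Longrightarrow> norm (f x) < e / 2"
    using f(1) e unfolding C0_def by blast
  have "norm (g x) < e" if "x \<notin> K" for x
    using K(2)[OF that] f(2)[of x] norm_triangle_sub[of "g x" "f x"] by linarith
  then show "\<exists>K. compact K \<and> (\<forall>x. x \<notin> K \<longrightarrow> norm (g x) < e)" using K(1) by blast
qed

lemma C0_geometric_sum:
  fixes \<phi> :: "nat \<Rightarrow> ('a::topological_space \<Rightarrow>\<^sub>C complex)"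
  assumes phi: "\<And>n. \<phi> n \<in> C0" "\<And>n x. \<phi> n x = complex_of_real (p n x)"
    and p: "\<And>n x. 0 \<le> p n x" "\<And>n x. p n x \<le> 1"
  obtains a r where "a \<in> C0" "\<And>x. a x = complex_of_real (r x)" "\<And>x. 0 \<le> r x"
    "\<And>n x. p n x \<le> 2 ^ n * r x"
proof -
  define r where "r x = (\<Sum>n. (1/2) ^ n * p n x)" for x
  have bd: "norm ((1/2) ^ n * p n x) \<le> (1/2) ^ n" for n x
    using p[of n x] by (simp add: mult_left_le)
  have geo: "summable (\<lambda>n. (1/2 :: real) ^ n)" by (rule summable_geometric) simp
  have sm: "summable (\<lambda>n. (1/2) ^ n * p n x)" for x
    by (rule summable_comparison_test'[OF geo, of 0]) (rule bd)
  have ul: "uniform_limit UNIV (\<lambda>n x. \<Sum>i<n. (1/2) ^ i * p i x) r sequentially"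
    unfolding r_def by (rule Weierstrass_m_test[OF bd geo])
  have cp: "continuous_on UNIV (p n)" for n
  proof -
    have "p n = (\<lambda>x. Re (\<phi> n x))" by (simp add: phi)
    then show ?thesis by (metis continuous_on_Re continuous_on_apply_bcontfun)
  qed
  have cr: "continuous_on UNIV r"
    by (rule uniform_limit_theorem[OF _ ul]) (auto intro!: always_eventually continuous_intros cp)
  have r0: "0 \<le> r x" for x
    unfolding r_def using p by (intro suminf_nonneg sm) auto
  have r2: "r x \<le> 2" for x
  proof -
    have "r x \<le> (\<Sum>n. (1/2 :: real) ^ n)"
      unfolding r_def using bd by (intro suminf_le sm geo) (simp add: p)
    also have "\<dots> = 2" by (simp add: suminf_geometric)
    finally show ?thesis .
  qed
  define a where "a = Bcontfun (\<lambda>x. complex_of_real (r x))"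
  have a: "a x = complex_of_real (r x)" for x
    unfolding a_def
    by (rule apply_Bcontfun[where B = 2]) (use r0 r2 in \<open>auto intro!: continuous_intros cr simp: norm_of_real\<close>)
  define s where "s N = (\<Sum>i<N. cb_scale ((1/2) ^ i) (\<phi> i))" for N
  have sC0: "s N \<in> C0" for N
    by (induction N) (auto simp: s_def C0_0 intro!: C0_add C0_scale phi)
  have s: "s N x = complex_of_real (\<Sum>i<N. (1/2) ^ i * p i x)" for N x
    by (induction N) (auto simp: s_def phi)
  have "a \<in> C0"
  proof (rule C0_uniform_closed)
    fix e :: real assume "e > 0"
    then obtain N where N: "\<And>x. dist (\<Sum>i<N. (1/2) ^ i * p i x) (r x) < e"
      using uniform_limitD[OF ul \<open>e > 0\<close>] unfolding eventually_sequentially by blast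
    have "norm (a x - s N x) < e" for x
      unfolding a s of_real_diff[symmetric] norm_of_real using N[of x] by (simp add: dist_real_def abs_minus_commute)
    then show "\<exists>f\<in>C0. \<forall>x. norm (a x - f x) < e" using sC0 by blast
  qed
  moreover have "p n x \<le> 2 ^ n * r x" for n x
  proof -
    have "(1/2) ^ n * p n x \<le> r x"
      unfolding r_def using sum_le_suminf[OF sm, of "{n}"] p by simp
    then have "2 ^ n * ((1/2) ^ n * p n x) \<le> 2 ^ n * r x" by (intro mult_left_mono) auto
    then show ?thesis by (simp add: power_one_over)
  qed
  ultimately show thesis using that a r0 by blast
qed

text \<open>
  Bounded functionals are continuous for one seminorm of the strict topology. Choose \<open>\<phi> n\<close> by
  tightness with error \<open>4 ^ -n\<close> and put \<open>a = \<Sum>n. 2 ^ -n * \<phi> n\<close>, so that \<open>\<parallel>h \<phi> n\<parallel> \<le> 2 ^ n \<parallel>h a\<parallel>\<close>.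
  The difference of \<open>\<mu> (h \<phi> (n+1))\<close> and \<open>\<mu> (h \<phi> n)\<close> equals
  \<open>\<mu> (h \<phi> (n+1) (1 - \<phi> n)) - \<mu> (h \<phi> n (1 - \<phi> (n+1)))\<close> and is therefore at most
  \<open>3 * 2 ^ -n * \<parallel>h a\<parallel>\<close>. Summing up and letting \<open>n\<close> tend to infinity gives the claim.
\<close>

lemma C0_dual_strict_bound:
  fixes \<mu> :: "('a::topological_space \<Rightarrow>\<^sub>C complex) \<Rightarrow> complex"
  assumes mu: "\<mu> \<in> C0_dual"
  obtains a r C where "a \<in> C0" "\<And>x. a x = complex_of_real (r x)" "\<And>x. 0 \<le> r x" "C \<ge> 0"
    "\<And>h. h \<in> C0 \<Longrightarrow> norm (\<mu> h) \<le> C * norm (h \<bullet>\<^sub>C a)"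
proof -
  have "\<exists>\<phi> p. \<phi> \<in> C0 \<and> (\<forall>x. \<phi> x = complex_of_real (p x)) \<and> (\<forall>x. 0 \<le> p x) \<and> (\<forall>x. p x \<le> 1) \<and>
      (\<forall>h\<in>C0. norm (\<mu> (h - h \<bullet>\<^sub>C \<phi>)) \<le> (1/4) ^ n * norm h)" for n :: nat
  proof -
    have "(1/4 :: real) ^ n > 0" by simp
    then show ?thesis by (rule C0_dual_tight[OF mu]) blast
  qed
  then obtain \<phi> p where phi: "\<And>n. \<phi> n \<in> C0" "\<And>n x. \<phi> n x = complex_of_real (p n x)"
    and p: "\<And>n x. 0 \<le> p n x" "\<And>n x. p n x \<le> 1"
    and tight: "\<And>n h. h \<in> C0 \<Longrightarrow> norm (\<mu> (h - h \<bullet>\<^sub>C \<phi> n)) \<le> (1/4) ^ n * norm h"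
    by metis
  obtain a r where a: "a \<in> C0" "\<And>x. a x = complex_of_real (r x)" "\<And>x. 0 \<le> r x"
    and pr: "\<And>n x. p n x \<le> 2 ^ n * r x"
    using C0_geometric_sum[of \<phi> p, OF phi p] by blast
  obtain B where B: "B \<ge> 0" "\<And>f. f \<in> C0 \<Longrightarrow> norm (\<mu> f) \<le> B * norm f"
    using C0_dual_bound[OF mu] by blast
  \<comment> \<open>\<open>B\<close> bounds the term \<open>\<mu> (h \<phi> 0)\<close>, and \<open>6 = 3 * (\<Sum>n. 2 ^ -n)\<close> the sum of the differences\<close>
  have bound: "norm (\<mu> h) \<le> (B + 6) * norm (h \<bullet>\<^sub>C a)" if h: "h \<in> C0" for h
  proof -
    define N where "N = norm (h \<bullet>\<^sub>C a)"
    have N: "norm (h \<bullet>\<^sub>C \<phi> n) \<le> 2 ^ n * N" for n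
      unfolding N_def
    proof (rule norm_bcontfun_mono)
      fix x
      have "norm (h x) * p n x \<le> norm (h x) * (2 ^ n * r x)" by (intro mult_left_mono pr) auto
      then show "\<exists>y. norm ((h \<bullet>\<^sub>C \<phi> n) x) \<le> 2 ^ n * norm ((h \<bullet>\<^sub>C a) y)"
        using p[of n x] a(3)[of x] by (intro exI[of _ x]) (simp add: phi a norm_mult norm_of_real mult_ac)
    qed simp
    have C0: "h \<bullet>\<^sub>C \<phi> n \<in> C0" for n using h by (rule C0_mult_left)
    have tel: "norm (\<mu> (h \<bullet>\<^sub>C \<phi> n)) \<le> (B + 3 * (\<Sum>i<n. (1/2) ^ i)) * N" for n
    proof (induction n)
      case 0
      have "norm (\<mu> (h \<bullet>\<^sub>C \<phi> 0)) \<le> B * N"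
        using B(2)[OF C0[of 0]] mult_left_mono[OF N[of 0] B(1)] by simp
      then show ?case by simp
    next
      case (Suc n)
      let ?u = "h \<bullet>\<^sub>C \<phi> n" and ?v = "h \<bullet>\<^sub>C \<phi> (Suc n)"
      have comm: "?v \<bullet>\<^sub>C \<phi> n = ?u \<bullet>\<^sub>C \<phi> (Suc n)" by (rule bcontfun_eqI) simp
      have "\<mu> (?v - ?v \<bullet>\<^sub>C \<phi> n) = \<mu> ?v - \<mu> (?u \<bullet>\<^sub>C \<phi> (Suc n))"
        "\<mu> (?u - ?u \<bullet>\<^sub>C \<phi> (Suc n)) = \<mu> ?u - \<mu> (?u \<bullet>\<^sub>C \<phi> (Suc n))"
        unfolding comm by (intro C0_dual_diff[OF mu] C0 C0_mult_left)+
      then have eq: "norm (\<mu> ?v) = norm (\<mu> ?u + \<mu> (?v - ?v \<bullet>\<^sub>C \<phi> n) - \<mu> (?u - ?u \<bullet>\<^sub>C \<phi> (Suc n)))"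
        by simp
      have "norm (\<mu> ?v) \<le> norm (\<mu> ?u) + norm (\<mu> (?v - ?v \<bullet>\<^sub>C \<phi> n)) + norm (\<mu> (?u - ?u \<bullet>\<^sub>C \<phi> (Suc n)))"
        unfolding eq using norm_triangle_ineq4[of "\<mu> ?u + \<mu> (?v - ?v \<bullet>\<^sub>C \<phi> n)" "\<mu> (?u - ?u \<bullet>\<^sub>C \<phi> (Suc n))"]
          norm_triangle_ineq[of "\<mu> ?u" "\<mu> (?v - ?v \<bullet>\<^sub>C \<phi> n)"] by linarith
      moreover have "norm (\<mu> (?v - ?v \<bullet>\<^sub>C \<phi> n)) \<le> 2 * (1/2) ^ n * N"
      proof -
        have "norm (\<mu> (?v - ?v \<bullet>\<^sub>C \<phi> n)) \<le> (1/4) ^ n * (2 ^ Suc n * N)"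
          by (rule order_trans[OF tight[OF C0[of "Suc n"], of n] mult_left_mono[OF N[of "Suc n"]]]) simp
        also have "\<dots> = 2 * ((1/4) ^ n * 2 ^ n) * N" by simp
        also have "(1/4 :: real) ^ n * 2 ^ n = (1/2) ^ n" by (simp flip: power_mult_distrib)
        finally show ?thesis .
      qed
      moreover have "norm (\<mu> (?u - ?u \<bullet>\<^sub>C \<phi> (Suc n))) \<le> (1/2) ^ n * N"
      proof -
        have "norm (\<mu> (?u - ?u \<bullet>\<^sub>C \<phi> (Suc n))) \<le> (1/4) ^ Suc n * (2 ^ n * N)"
          by (rule order_trans[OF tight[OF C0[of n], of "Suc n"] mult_left_mono[OF N[of n]]]) simp
        also have "\<dots> = (1/4) * ((1/4) ^ n * 2 ^ n) * N" by simp
        also have "(1/4 :: real) ^ n * 2 ^ n = (1/2) ^ n" by (simp flip: power_mult_distrib)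
        finally have "norm (\<mu> (?u - ?u \<bullet>\<^sub>C \<phi> (Suc n))) \<le> (1/4) * ((1/2) ^ n * N)" by simp
        moreover have "(1/2) ^ n * N \<ge> 0" by (simp add: N_def)
        ultimately show ?thesis by linarith
      qed
      ultimately show ?case using Suc.IH by (simp add: algebra_simps)
    qed
    have geo: "(\<Sum>i<n. (1/2 :: real) ^ i) \<le> 2" for n by (simp add: sum_gp_strict)
    have "norm (\<mu> h) \<le> (B + 6) * N + e" if e: "e > 0" for e
    proof -
      have pos: "e / (norm h + 1) > 0"
        using e norm_ge_zero[of h] by (intro divide_pos_pos) linarith+
      obtain n where n: "(1/4) ^ n < e / (norm h + 1)"
        using real_arch_pow_inv[OF pos, of "1/4"] by auto
      have "(1/4) ^ n * norm h \<le> e / (norm h + 1) * (norm h + 1)"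
        using n pos by (intro mult_mono) auto
      also have "\<dots> = e" using norm_ge_zero[of h] by (simp add: add_nonneg_eq_0_iff)
      finally have "norm (\<mu> (h - h \<bullet>\<^sub>C \<phi> n)) \<le> e" using tight[OF h, of n] by linarith
      moreover have "norm (\<mu> (h \<bullet>\<^sub>C \<phi> n)) \<le> (B + 6) * N"
      proof -
        have "B + 3 * (\<Sum>i<n. (1/2) ^ i) \<le> B + 6" using geo[of n] by linarith
        then have "(B + 3 * (\<Sum>i<n. (1/2) ^ i)) * N \<le> (B + 6) * N"
          by (rule mult_right_mono) (simp add: N_def)
        then show ?thesis using tel[of n] by linarith
      qed
      moreover have "\<mu> h = \<mu> (h \<bullet>\<^sub>C \<phi> n) + \<mu> (h - h \<bullet>\<^sub>C \<phi> n)"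
        by (simp add: C0_dual_diff[OF mu h C0])
      ultimately show ?thesis
        using norm_triangle_ineq[of "\<mu> (h \<bullet>\<^sub>C \<phi> n)" "\<mu> (h - h \<bullet>\<^sub>C \<phi> n)"] by simp
    qed
    then show ?thesis unfolding N_def by (rule field_le_epsilon)
  qed
  show thesis using that[OF a, of "B + 6"] B(1) bound by simp
qed

text \<open>
  The extension is \<open>m f = lim \<mu> (f \<theta> n)\<close> for the approximate unit \<open>\<theta> n = (n+1) a / (1 + (n+1) a)\<close>.
  It is adapted to \<open>a\<close> in that \<open>(1 - \<theta> n) a \<le> 1 / (n+1)\<close>, so that \<open>f \<theta> n\<close> tends to \<open>f\<close> in the
  one seminorm that dominates \<open>\<mu>\<close>.
\<close>

lemma C0_dual_strict_extension:
  fixes \<mu> :: "('a::topological_space \<Rightarrow>\<^sub>C complex) \<Rightarrow> complex"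
  assumes mu: "\<mu> \<in> C0_dual"
  obtains m a C where "a \<in> C0" "C \<ge> 0" "\<And>f g. m (f + g) = m f + m g" "\<And>c f. m (cb_scale c f) = c * m f"
    "\<And>f. f \<in> C0 \<Longrightarrow> m f = \<mu> f" "\<And>f. norm (m f) \<le> C * norm (f \<bullet>\<^sub>C a)"
proof -
  obtain a r C where a: "a \<in> C0" "\<And>x. a x = complex_of_real (r x)" "\<And>x. 0 \<le> r x" and C: "C \<ge> 0"
    and bound: "\<And>h. h \<in> C0 \<Longrightarrow> norm (\<mu> h) \<le> C * norm (h \<bullet>\<^sub>C a)"
    using C0_dual_strict_bound[OF mu] by metis
  have r: "r = (\<lambda>x. Re (a x))" by (simp add: a(2))
  have cr: "continuous_on UNIV r" unfolding r by (intro continuous_intros) simp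
  define t where "t n x = real (Suc n) * r x / (1 + real (Suc n) * r x)" for n x
  have den: "1 + real (Suc n) * r x > 0" for n x
    using a(3)[of x] by (intro add_pos_nonneg mult_nonneg_nonneg) auto
  have t: "0 \<le> t n x" "t n x \<le> 1" "t n x \<le> real (Suc n) * r x" "(1 - t n x) * r x \<le> inverse (real (Suc n))"
    for n x
  proof -
    let ?y = "real (Suc n) * r x"
    have y: "?y \<ge> 0" using a(3)[of x] by (intro mult_nonneg_nonneg) auto
    show "0 \<le> t n x" "t n x \<le> 1" using y den[of n x] by (auto simp: t_def)
    have "?y / (1 + ?y) \<le> ?y / 1" using y by (intro divide_left_mono) auto
    then show "t n x \<le> ?y" by (simp add: t_def)
    have "(1 - t n x) * ?y = ?y / (1 + ?y)" using den[of n x] unfolding t_def by (simp add: field_simps)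
    also have "\<dots> \<le> 1" using y by simp
    finally have "real (Suc n) * ((1 - t n x) * r x) \<le> 1" by (simp add: mult_ac)
    then show "(1 - t n x) * r x \<le> inverse (real (Suc n))"
      by (simp add: inverse_eq_divide pos_le_divide_eq mult_ac del: of_nat_Suc)
  qed
  define \<theta> where "\<theta> n = Bcontfun (\<lambda>x. complex_of_real (t n x))" for n
  have theta: "\<theta> n x = complex_of_real (t n x)" for n x
    unfolding \<theta>_def
  proof (rule apply_Bcontfun[where B = 1])
    show "continuous_on UNIV (\<lambda>x. complex_of_real (t n x))"
      unfolding t_def by (intro continuous_intros cr) (use den[of n] in \<open>metis less_irrefl\<close>)
    show "norm (complex_of_real (t n x)) \<le> 1" for x using t[of n x] by (simp add: norm_of_real)
  qed
  have thetaC0: "\<theta> n \<in> C0" for n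
    by (rule C0_dominated[OF a(1), where C = "real (Suc n)"])
      (use t[of n] a(3) in \<open>simp add: theta a(2) norm_of_real\<close>)
  have fC0: "f \<bullet>\<^sub>C \<theta> n \<in> C0" for f n by (rule C0_mult_right[OF thetaC0])
  have approx: "norm ((f \<bullet>\<^sub>C \<theta> n - f) \<bullet>\<^sub>C a) \<le> norm f * inverse (real (Suc n))" for f n
  proof (rule norm_bound)
    fix x
    have "((f \<bullet>\<^sub>C \<theta> n - f) \<bullet>\<^sub>C a) x = - (f x * complex_of_real ((1 - t n x) * r x))"
      by (simp add: theta a(2) algebra_simps)
    then have "norm (((f \<bullet>\<^sub>C \<theta> n - f) \<bullet>\<^sub>C a) x) = norm (f x) * ((1 - t n x) * r x)"
      using t[of n x] a(3)[of x] by (simp only: norm_minus_cancel norm_mult norm_of_real) simp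
    also have "\<dots> \<le> norm f * inverse (real (Suc n))"
      using t[of n x] a(3)[of x] by (intro mult_mono norm_bounded) auto
    finally show "norm (((f \<bullet>\<^sub>C \<theta> n - f) \<bullet>\<^sub>C a) x) \<le> norm f * inverse (real (Suc n))" .
  qed
  have lim0: "(\<lambda>n. K * inverse (real (Suc n))) \<longlonglongrightarrow> 0" for K
    using tendsto_mult_right_zero[OF LIMSEQ_inverse_real_of_nat] by simp
  have conv: "convergent (\<lambda>n. \<mu> (f \<bullet>\<^sub>C \<theta> n))" for f
  proof -
    have est: "norm (\<mu> (f \<bullet>\<^sub>C \<theta> i) - \<mu> (f \<bullet>\<^sub>C \<theta> j)) \<le> 
        C * norm f * inverse (real (Suc i)) + C * norm f * inverse (real (Suc j))" for i j
    proof -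
      have "norm (\<mu> (f \<bullet>\<^sub>C \<theta> i) - \<mu> (f \<bullet>\<^sub>C \<theta> j)) \<le> C * norm ((f \<bullet>\<^sub>C \<theta> i - f \<bullet>\<^sub>C \<theta> j) \<bullet>\<^sub>C a)"
        using bound[OF C0_diff[OF fC0 fC0]] by (simp add: C0_dual_diff[OF mu fC0 fC0])
      also have "(f \<bullet>\<^sub>C \<theta> i - f \<bullet>\<^sub>C \<theta> j) \<bullet>\<^sub>C a = (f \<bullet>\<^sub>C \<theta> i - f) \<bullet>\<^sub>C a - (f \<bullet>\<^sub>C \<theta> j - f) \<bullet>\<^sub>C a"
        by (simp add: cb_mult_diff_left)
      also have "C * norm \<dots> \<le> C * (norm f * inverse (real (Suc i)) + norm f * inverse (real (Suc j)))"
        using approx[of f i] approx[of f j] C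
          norm_triangle_ineq4[of "(f \<bullet>\<^sub>C \<theta> i - f) \<bullet>\<^sub>C a" "(f \<bullet>\<^sub>C \<theta> j - f) \<bullet>\<^sub>C a"]
        by (intro mult_left_mono) linarith+
      finally show ?thesis by (simp add: distrib_left mult.assoc)
    qed
    have "Cauchy (\<lambda>n. \<mu> (f \<bullet>\<^sub>C \<theta> n))"
    proof (rule CauchyI)
      fix e :: real assume "e > 0"
      then have "\<forall>\<^sub>F n in sequentially. C * norm f * inverse (real (Suc n)) < e / 2"
        using order_tendstoD(2)[OF lim0, of "e / 2"] by simp
      then obtain N where N: "\<And>n. n \<ge> N \<Longrightarrow> C * norm f * inverse (real (Suc n)) < e / 2"
        unfolding eventually_sequentially by blast
      have "norm (\<mu> (f \<bullet>\<^sub>C \<theta> i) - \<mu> (f \<bullet>\<^sub>C \<theta> j)) < e" if "i \<ge> N" "j \<ge> N" for i j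
        using est[of i j] N[OF that(1)] N[OF that(2)] by linarith
      then show "\<exists>M. \<forall>m\<ge>M. \<forall>n\<ge>M. norm (\<mu> (f \<bullet>\<^sub>C \<theta> m) - \<mu> (f \<bullet>\<^sub>C \<theta> n)) < e"
        by (intro exI[of _ N] allI impI)
    qed
    then show ?thesis by (rule Cauchy_convergent)
  qed
  define m where "m f = lim (\<lambda>n. \<mu> (f \<bullet>\<^sub>C \<theta> n))" for f
  have m: "(\<lambda>n. \<mu> (f \<bullet>\<^sub>C \<theta> n)) \<longlonglongrightarrow> m f" for f
    unfolding m_def by (rule convergent_LIMSEQ_iff[THEN iffD1, OF conv])
  show thesis
  proof (rule that[OF a(1) C])
    show "m (f + g) = m f + m g" for f g
    proof (rule LIMSEQ_unique[OF m])
      show "(\<lambda>n. \<mu> ((f + g) \<bullet>\<^sub>C \<theta> n)) \<longlonglongrightarrow> m f + m g"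
        using tendsto_add[OF m[of f] m[of g]] by (simp add: cb_mult_add_left C0_dual_add[OF mu fC0 fC0])
    qed
    show "m (cb_scale c f) = c * m f" for c f
    proof (rule LIMSEQ_unique[OF m])
      show "(\<lambda>n. \<mu> (cb_scale c f \<bullet>\<^sub>C \<theta> n)) \<longlonglongrightarrow> c * m f"
        using tendsto_mult_left[OF m[of f], of c] by (simp add: cb_mult_scale_left C0_dual_scale[OF mu fC0])
    qed
    show "m f = \<mu> f" if f: "f \<in> C0" for f
    proof (rule LIMSEQ_unique[OF m])
      have "norm (\<mu> (f \<bullet>\<^sub>C \<theta> n) - \<mu> f) \<le> C * norm f * inverse (real (Suc n))" for n
        using bound[OF C0_diff[OF fC0[of f n] f]] mult_left_mono[OF approx[of f n] C]
        by (simp add: C0_dual_diff[OF mu fC0 f] mult.assoc)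
      then have "(\<lambda>n. \<mu> (f \<bullet>\<^sub>C \<theta> n) - \<mu> f) \<longlonglongrightarrow> 0"
        by (intro Lim_null_comparison[OF _ lim0[of "C * norm f"]] always_eventually allI)
      then show "(\<lambda>n. \<mu> (f \<bullet>\<^sub>C \<theta> n)) \<longlonglongrightarrow> \<mu> f" by (rule LIM_zero_cancel)
    qed
    show "norm (m f) \<le> C * norm (f \<bullet>\<^sub>C a)" for f
    proof (rule LIMSEQ_le_const2[OF tendsto_norm[OF m]])
      have "norm (\<mu> (f \<bullet>\<^sub>C \<theta> n)) \<le> C * norm (f \<bullet>\<^sub>C a)" for n
      proof -
        have "norm ((f \<bullet>\<^sub>C \<theta> n) \<bullet>\<^sub>C a) \<le> 1 * norm (f \<bullet>\<^sub>C a)"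
        proof (rule norm_bcontfun_mono)
          fix x
          have "(norm (f x) * r x) * t n x \<le> (norm (f x) * r x) * 1"
            using t[of n x] a(3)[of x] by (intro mult_left_mono) auto
          then show "\<exists>y. norm (((f \<bullet>\<^sub>C \<theta> n) \<bullet>\<^sub>C a) x) \<le> 1 * norm ((f \<bullet>\<^sub>C a) y)"
            using t[of n x] a(3)[of x]
            by (intro exI[of _ x]) (simp add: theta a(2) norm_mult norm_of_real mult_ac)
        qed simp
        then have "C * norm ((f \<bullet>\<^sub>C \<theta> n) \<bullet>\<^sub>C a) \<le> C * norm (f \<bullet>\<^sub>C a)"
          using C by (intro mult_left_mono) simp_all
        with bound[OF fC0] show ?thesis by (rule order_trans)
      qed
      then show "\<exists>N. \<forall>n\<ge>N. norm (\<mu> (f \<bullet>\<^sub>C \<theta> n)) \<le> C * norm (f \<bullet>\<^sub>C a)"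
        by (intro exI allI impI)
    qed
  qed
qed


section \<open>Slice maps\<close>

definition strict_linear ::
    "(('a::topological_space \<Rightarrow>\<^sub>C complex) \<Rightarrow> ('b::topological_space \<Rightarrow>\<^sub>C complex)) \<Rightarrow> bool"
  where "strict_linear T \<longleftrightarrow> Vector_Spaces.linear cb_scale cb_scale T \<and>
    continuous_map strict_topology strict_topology T"

lemma strict_linearI:
  assumes "\<And>f g. T (f + g) = T f + T g" "\<And>c f. T (cb_scale c f) = cb_scale c (T f)"
    and "\<And>c. c \<in> C0 \<Longrightarrow> \<exists>d\<in>C0. \<exists>C. \<forall>F. norm (T F \<bullet>\<^sub>C c) \<le> C * norm (F \<bullet>\<^sub>C d)"
  shows "strict_linear T"
proof -
  have "Vector_Spaces.linear cb_scale cb_scale T"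
    unfolding Vector_Spaces.linear_iff using assms(1,2) by (simp add: vector_space_cb_scale)
  then show ?thesis
    unfolding strict_linear_def using strictly_continuous_linear[OF _ assms(3)] by blast
qed

lemma strict_linear_compose:
  assumes "strict_linear S" "strict_linear T"
  shows "strict_linear (\<lambda>f. T (S f))"
  using assms continuous_map_compose[of strict_topology strict_topology S strict_topology T]
  unfolding strict_linear_def Vector_Spaces.linear_iff by (simp add: o_def)

lemma strict_linear_mult: "strict_linear (\<lambda>F. F \<bullet>\<^sub>C t)"
proof (rule strict_linearI)
  show "\<exists>d\<in>C0. \<exists>C. \<forall>F. norm ((F \<bullet>\<^sub>C t) \<bullet>\<^sub>C c) \<le> C * norm (F \<bullet>\<^sub>C d)" if "c \<in> C0" for c
  proof (intro bexI exI allI)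
    show "t \<bullet>\<^sub>C c \<in> C0" using that by (rule C0_mult_right)
    have "(F \<bullet>\<^sub>C t) \<bullet>\<^sub>C c = F \<bullet>\<^sub>C (t \<bullet>\<^sub>C c)" for F by (rule bcontfun_eqI) simp
    then show "norm ((F \<bullet>\<^sub>C t) \<bullet>\<^sub>C c) \<le> 1 * norm (F \<bullet>\<^sub>C (t \<bullet>\<^sub>C c))" for F by simp
  qed
qed (auto simp: cb_mult_add_left cb_mult_scale_left)

lemma strict_linear_swap:
  "strict_linear (cb_swap :: (('a::topological_space \<times> 'b::topological_space) \<Rightarrow>\<^sub>C complex) \<Rightarrow> _)"
proof (rule strict_linearI)
  show "cb_swap (F + G) = cb_swap F + cb_swap G"
    for F G :: "('a \<times> 'b) \<Rightarrow>\<^sub>C complex"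
    by (rule bcontfun_eqI) (auto simp: split_paired_all)
  show "cb_swap (cb_scale c F) = cb_scale c (cb_swap F)" for c and F :: "('a \<times> 'b) \<Rightarrow>\<^sub>C complex"
    by (rule bcontfun_eqI) (auto simp: split_paired_all)
  show "\<exists>d\<in>C0. \<exists>C. \<forall>F :: ('a \<times> 'b) \<Rightarrow>\<^sub>C complex. norm (cb_swap F \<bullet>\<^sub>C c) \<le> C * norm (F \<bullet>\<^sub>C d)"
    if c: "c \<in> C0" for c :: "('b \<times> 'a) \<Rightarrow>\<^sub>C complex"
  proof (intro bexI exI allI)
    show "cb_swap c \<in> C0"
      unfolding C0_def
    proof (intro CollectI allI impI)
      fix e :: real assume "e > 0"
      then obtain K where K: "compact K" "\<And>z. z \<notin> K \<Longrightarrow> norm (c z) < e"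
        using c unfolding C0_def by blast
      have "compact (prod.swap ` K)"
        by (rule compact_continuous_image[OF _ K(1)]) (auto simp: prod.swap_def intro!: continuous_intros)
      moreover have "norm (cb_swap c z) < e" if "z \<notin> prod.swap ` K" for z
      proof -
        obtain x y where z: "z = (x, y)" by force
        then have "(y, x) \<notin> K" using that by force
        then show ?thesis using K(2) by (simp add: z)
      qed
      ultimately show "\<exists>K. compact K \<and> (\<forall>x. x \<notin> K \<longrightarrow> norm (cb_swap c x) < e)" by blast
    qed
    fix F :: "('a \<times> 'b) \<Rightarrow>\<^sub>C complex"
    show "norm (cb_swap F \<bullet>\<^sub>C c) \<le> 1 * norm (F \<bullet>\<^sub>C cb_swap c)"
    proof (rule norm_bcontfun_mono)
      fix z :: "'b \<times> 'a"
      obtain x y where z: "z = (x, y)" by force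
      show "\<exists>w. norm ((cb_swap F \<bullet>\<^sub>C c) z) \<le> 1 * norm ((F \<bullet>\<^sub>C cb_swap c) w)"
        by (rule exI[of _ "(y, x)"]) (simp add: z)
    qed simp
  qed
qed

text \<open>
  The sections of \<open>F\<close> depend continuously on the point for each strict seminorm, because \<open>F\<close> is
  continuous uniformly along compact sets; for the sup norm this fails in general.
\<close>

lemma tendsto_cb_section:
  fixes F :: "('a::topological_space \<times> 'b::topological_space) \<Rightarrow>\<^sub>C complex"
  assumes a: "a \<in> C0" and e: "e > 0"
  obtains U where "open U" "x0 \<in> U" "\<And>x. x \<in> U \<Longrightarrow> norm ((cb_section F x - cb_section F x0) \<bullet>\<^sub>C a) \<le> e"
proof -
  define M where "M = 2 * norm F + norm a + 1"
  have M: "M > 0" "2 * norm F \<le> M" "norm a \<le> M"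
    using norm_ge_zero[of F] norm_ge_zero[of a] unfolding M_def by linarith+
  then have eM: "e / M > 0" using e by simp
  obtain K where K: "compact K" "\<And>y. y \<notin> K \<Longrightarrow> norm (a y) < e / M"
    using a eM unfolding C0_def by blast
  have cF: "continuous_on (UNIV \<times> K) F" by simp
  obtain U where U: "x0 \<in> U" "open U" "\<forall>x\<in>U \<inter> UNIV. \<forall>y\<in>K. dist (F (x, y)) (F (x0, y)) \<le> e / M"
    using continuous_on_prod_compactE[OF cF K(1) UNIV_I eM] by metis
  have "norm ((cb_section F x - cb_section F x0) \<bullet>\<^sub>C a) \<le> e" if x: "x \<in> U" for x
  proof (rule norm_bound)
    fix y
    have "norm (F (x, y) - F (x0, y)) * norm (a y) \<le> e"
    proof (cases "y \<in> K")
      case True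
      then have "norm (F (x, y) - F (x0, y)) \<le> e / M" using U(3) x by (simp add: dist_norm)
      then have "norm (F (x, y) - F (x0, y)) * norm (a y) \<le> e / M * M"
        using eM M(3) norm_bounded[of a y] by (intro mult_mono) auto
      then show ?thesis using M(1) by simp
    next
      case False
      have "norm (F (x, y) - F (x0, y)) \<le> M"
        using norm_triangle_ineq4[of "F (x, y)" "F (x0, y)"] norm_bounded[of F "(x, y)"]
          norm_bounded[of F "(x0, y)"] M(2) by linarith
      then have "norm (F (x, y) - F (x0, y)) * norm (a y) \<le> M * (e / M)"
        using M(1) K(2)[OF False] by (intro mult_mono) auto
      then show ?thesis using M(1) by simp
    qed
    then show "norm (((cb_section F x - cb_section F x0) \<bullet>\<^sub>C a) y) \<le> e" by (simp add: norm_mult)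
  qed
  then show thesis using that U(1,2) by blast
qed

text \<open>
  With \<open>m\<close> the strict extension of \<open>\<mu>\<close> and \<open>|m f| \<le> C \<parallel>f a\<parallel>\<close>, the slice of \<open>F\<close> is the function
  \<open>x \<mapsto> m (F (x, _))\<close>. Strict continuity comes from
  \<open>|c x * m (F (x, _))| = |m (c x * F (x, _))| \<le> C \<parallel>F (c \<otimes> a)\<parallel>\<close>.
\<close>

lemma slice_exists:
  fixes \<mu> :: "('b::topological_space \<Rightarrow>\<^sub>C complex) \<Rightarrow> complex"
  assumes mu: "\<mu> \<in> C0_dual"
  obtains T :: "(('a::topological_space \<times> 'b) \<Rightarrow>\<^sub>C complex) \<Rightarrow> ('a \<Rightarrow>\<^sub>C complex)"
  where "strict_linear T" "\<And>a b. a \<in> C0 \<Longrightarrow> b \<in> C0 \<Longrightarrow> T (tensor a b) = cb_scale (\<mu> b) a"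
proof -
  obtain m a C where a: "a \<in> C0" and C: "C \<ge> 0" and m_add: "\<And>f g. m (f + g) = m f + m g"
    and m_scale: "\<And>c f. m (cb_scale c f) = c * m f"
    and m_mu: "\<And>f. f \<in> C0 \<Longrightarrow> m f = \<mu> f" and m_bound: "\<And>f. norm (m f) \<le> C * norm (f \<bullet>\<^sub>C a)"
    using C0_dual_strict_extension[OF mu] by metis
  have m_diff: "m (f - g) = m f - m g" for f g using m_add[of "f - g" g] by simp
  define T where "T F = Bcontfun (\<lambda>x. m (cb_section F x))" for F :: "('a \<times> 'b) \<Rightarrow>\<^sub>C complex"
  have T: "T F x = m (cb_section F x)" for F x
    unfolding T_def
  proof (rule apply_Bcontfun[where B = "C * (norm F * norm a)"])
    show "continuous_on UNIV (\<lambda>x. m (cb_section F x))"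
      unfolding continuous_on_def
    proof (intro ballI tendstoI)
      fix x0 :: 'a and e :: real assume e: "e > 0"
      then have "e / (2 * (C + 1)) > 0" using C by simp
      then obtain U where U: "open U" "x0 \<in> U"
        "\<And>x. x \<in> U \<Longrightarrow> norm ((cb_section F x - cb_section F x0) \<bullet>\<^sub>C a) \<le> e / (2 * (C + 1))"
        using tendsto_cb_section[OF a] by metis
      have "dist (m (cb_section F x)) (m (cb_section F x0)) < e" if x: "x \<in> U" for x
      proof -
        have "norm (m (cb_section F x - cb_section F x0)) \<le> C * (e / (2 * (C + 1)))"
          using m_bound mult_left_mono[OF U(3)[OF x] C] order_trans by blast
        also have "\<dots> \<le> (C + 1) * (e / (2 * (C + 1)))" using e C by (intro mult_right_mono) auto
        also have "\<dots> = e / 2" using C by (simp add: field_simps)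
        finally show ?thesis using e by (simp add: dist_norm m_diff)
      qed
      then show "\<forall>\<^sub>F x in at x0 within UNIV. dist (m (cb_section F x)) (m (cb_section F x0)) < e"
        unfolding eventually_at_topological using U(1,2) by blast
    qed
    show "norm (m (cb_section F x)) \<le> C * (norm F * norm a)" for x
    proof -
      have "norm (cb_section F x) \<le> norm F" by (rule norm_bound) (simp add: norm_bounded)
      then have "norm (cb_section F x \<bullet>\<^sub>C a) \<le> norm F * norm a"
        using norm_cb_mult[of "cb_section F x" a] mult_right_mono[of "norm (cb_section F x)" "norm F" "norm a"]
        by simp
      then show ?thesis using m_bound mult_left_mono[OF _ C] order_trans by blast
    qed
  qed
  have sec_add: "cb_section (F + G) x = cb_section F x + cb_section G x" for F G :: "('a \<times> 'b) \<Rightarrow>\<^sub>C complex" and x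
    by (rule bcontfun_eqI) simp
  have sec_scale: "cb_section (cb_scale c F) x = cb_scale c (cb_section F x)" for F :: "('a \<times> 'b) \<Rightarrow>\<^sub>C complex" and c x
    by (rule bcontfun_eqI) simp
  show thesis
  proof (rule that)
    show "strict_linear T"
    proof (rule strict_linearI)
      show "T (F + G) = T F + T G" for F G by (rule bcontfun_eqI) (simp add: T sec_add m_add)
      show "T (cb_scale c F) = cb_scale c (T F)" for c F
        by (rule bcontfun_eqI) (simp add: T sec_scale m_scale)
      show "\<exists>d\<in>C0. \<exists>C. \<forall>F. norm (T F \<bullet>\<^sub>C c) \<le> C * norm (F \<bullet>\<^sub>C d)" if c: "c \<in> C0" for c
      proof (intro bexI exI allI)
        show "tensor c a \<in> C0" by (rule tensor_C0[OF c a])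
        show "norm (T F \<bullet>\<^sub>C c) \<le> C * norm (F \<bullet>\<^sub>C tensor c a)" for F
        proof (rule norm_bound)
          fix x
          have "(T F \<bullet>\<^sub>C c) x = m (cb_scale (c x) (cb_section F x))" by (simp add: T m_scale)
          also have "norm \<dots> \<le> C * norm (cb_scale (c x) (cb_section F x) \<bullet>\<^sub>C a)" by (rule m_bound)
          also have "norm (cb_scale (c x) (cb_section F x) \<bullet>\<^sub>C a) \<le> norm (F \<bullet>\<^sub>C tensor c a)"
          proof (rule norm_bound)
            fix y
            show "norm ((cb_scale (c x) (cb_section F x) \<bullet>\<^sub>C a) y) \<le> norm (F \<bullet>\<^sub>C tensor c a)"
              using norm_bounded[of "F \<bullet>\<^sub>C tensor c a" "(x, y)"] by (simp add: mult_ac)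
          qed
          finally show "norm ((T F \<bullet>\<^sub>C c) x) \<le> C * norm (F \<bullet>\<^sub>C tensor c a)"
            using C by (simp add: mult_left_mono)
        qed
      qed
    qed
    show "T (tensor f b) = cb_scale (\<mu> b) f" if "f \<in> C0" "b \<in> C0" for f b
    proof (rule bcontfun_eqI)
      fix x
      have "cb_section (tensor f b) x = cb_scale (f x) b" by (rule bcontfun_eqI) simp
      then show "T (tensor f b) x = cb_scale (\<mu> b) f x" using that by (simp add: T m_scale m_mu)
    qed
  qed
qed

text \<open>
  The functions \<open>f (p z) * g (q z)\<close> are closed under products and conjugates, and they separate points
  because \<open>z \<mapsto> (p z, q z)\<close> is injective. The maps \<open>(x, y) \<mapsto> (x, y)\<close>, \<open>(x, y) \<mapsto> (x, x * y)\<close> and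
  \<open>(x, y) \<mapsto> (x * y, y)\<close> are the three instances needed.
\<close>

lemma strictly_dense_span_pullback_products:
  fixes p :: "'c::t2_space \<Rightarrow> 'a::t2_space" and q :: "'c \<Rightarrow> 'b::t2_space"
    and P :: "('a \<Rightarrow>\<^sub>C complex) \<Rightarrow> ('b \<Rightarrow>\<^sub>C complex) \<Rightarrow> ('c \<Rightarrow>\<^sub>C complex)"
  assumes lc: "locally_compact_space (euclidean :: 'a topology)"
    "locally_compact_space (euclidean :: 'b topology)"
    and inj: "\<And>z w. p z = p w \<Longrightarrow> q z = q w \<Longrightarrow> z = w"
    and P: "\<And>f g z. P f g z = f (p z) * g (q z)"
  shows "strictly_dense (cb.span {P f g | f g. f \<in> C0 \<and> g \<in> C0})"
    (is "strictly_dense (cb.span ?G)")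
proof (rule strict_Stone_Weierstrass)
  fix F G assume "F \<in> ?G" "G \<in> ?G"
  then obtain f g f' g' where F: "F = P f g" "f \<in> C0" "g \<in> C0"
    and G: "G = P f' g'" "f' \<in> C0" "g' \<in> C0"
    by blast
  have "F \<bullet>\<^sub>C G = P (f \<bullet>\<^sub>C f') (g \<bullet>\<^sub>C g')"
    by (rule bcontfun_eqI) (simp add: F G P)
  then show "F \<bullet>\<^sub>C G \<in> ?G"
    using F G by (intro CollectI exI[of _ "f \<bullet>\<^sub>C f'"] exI[of _ "g \<bullet>\<^sub>C g'"]) (simp add: C0_mult_left)
next
  fix F assume "F \<in> ?G"
  then obtain f g where F: "F = P f g" "f \<in> C0" "g \<in> C0" by blast
  have "cb_cnj F = P (cb_cnj f) (cb_cnj g)"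
    by (rule bcontfun_eqI) (simp add: F P)
  then show "cb_cnj F \<in> ?G"
    using F by (intro CollectI exI[of _ "cb_cnj f"] exI[of _ "cb_cnj g"]) (simp add: C0_cnj)
next
  fix z
  obtain f g where "f \<in> C0" "f (p z) = 1" "g \<in> C0" "g (q z) = 1"
    using C0_nonvanishing[OF lc(1)] C0_nonvanishing[OF lc(2)] by metis
  then show "\<exists>F\<in>?G. F z \<noteq> 0" by (intro bexI[of _ "P f g"]) (auto simp: P)
next
  fix z w :: 'c assume "z \<noteq> w"
  then consider "p z \<noteq> p w" | "q z \<noteq> q w" using inj by blast
  then obtain f g where "f \<in> C0" "g \<in> C0" "f (p z) = 1" "g (q z) = 1" "f (p w) = 0 \<or> g (q w) = 0"
  proof cases
    case 1
    then show ?thesis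
      using C0_separates[OF lc(1)] C0_nonvanishing[OF lc(2)] that by metis
  next
    case 2
    then show ?thesis
      using C0_separates[OF lc(2)] C0_nonvanishing[OF lc(1)] that by metis
  qed
  then show "\<exists>F\<in>?G. F z \<noteq> F w" by (intro bexI[of _ "P f g"]) (auto simp: P)
qed

lemma strictly_dense_span_tensor:
  assumes lc: "locally_compact_space (euclidean :: 'a::t2_space topology)"
    "locally_compact_space (euclidean :: 'b::t2_space topology)"
  shows "strictly_dense (cb.span {tensor a b | (a :: 'a \<Rightarrow>\<^sub>C complex) (b :: 'b \<Rightarrow>\<^sub>C complex).
    a \<in> C0 \<and> b \<in> C0})"
proof (rule strictly_dense_span_pullback_products[OF lc, of fst snd])
  show "tensor a b z = a (fst z) * b (snd z)" for a :: "'a \<Rightarrow>\<^sub>C complex" and b :: "'b \<Rightarrow>\<^sub>C complex" and z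
    by (cases z) simp
qed (simp add: prod_eq_iff)

text \<open>
  This is the uniqueness behind the definite descriptions \<^const>\<open>id_slice\<close> and \<^const>\<open>slice_id\<close>.
\<close>

lemma strict_linear_eq_on_tensors:
  fixes S T :: "(('a::t2_space \<times> 'b::t2_space) \<Rightarrow>\<^sub>C complex) \<Rightarrow> ('c::t2_space \<Rightarrow>\<^sub>C complex)"
  assumes lc: "locally_compact_space (euclidean :: 'a topology)"
    "locally_compact_space (euclidean :: 'b topology)" "locally_compact_space (euclidean :: 'c topology)"
    and S: "strict_linear S" and T: "strict_linear T"
    and eq: "\<And>a b. a \<in> C0 \<Longrightarrow> b \<in> C0 \<Longrightarrow> S (tensor a b) = T (tensor a b)"
  shows "S = T"
proof
  fix F :: "('a \<times> 'b) \<Rightarrow>\<^sub>C complex"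
  let ?G = "{tensor a b | (a :: 'a \<Rightarrow>\<^sub>C complex) (b :: 'b \<Rightarrow>\<^sub>C complex). a \<in> C0 \<and> b \<in> C0}"
  have lin: "module_hom cb_scale cb_scale S" "module_hom cb_scale cb_scale T"
    using S T unfolding strict_linear_def module_hom_iff_linear by auto
  have on_span: "S G = T G" if "G \<in> cb.span ?G" for G
    using that
  proof (induction rule: cb.span_induct_alt)
    case base
    show ?case using lin by (simp add: module_hom.zero)
  next
    case (step c x y)
    then have "S x = T x" using eq by blast
    then show ?case
      using lin step.IH by (simp add: module_hom.add module_hom.scale)
  qed
  have mem: "F \<in> strict_topology closure_of cb.span ?G"
    using strictly_dense_span_tensor[OF lc(1,2)] by (simp add: strictly_dense_def)
  have cont: "continuous_map strict_topology strict_topology S"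
    "continuous_map strict_topology strict_topology T"
    using S T by (simp_all add: strict_linear_def)
  show "S F = T F"
    by (rule forall_in_closure_of_eq[OF mem Hausdorff_strict[OF lc(3)] cont]) (rule on_span)
qed

lemma id_slice_eqI:
  fixes \<mu> :: "('a::t2_space \<Rightarrow>\<^sub>C complex) \<Rightarrow> complex"
  assumes lc: "locally_compact_space (euclidean :: 'a topology)"
    and T: "strict_linear T" "\<And>a b. a \<in> C0 \<Longrightarrow> b \<in> C0 \<Longrightarrow> T (tensor a b) = cb_scale (\<mu> b) a"
  shows "id_slice \<mu> = T"
  unfolding id_slice_def
proof (rule the_equality)
  show "Vector_Spaces.linear cb_scale cb_scale T \<and> continuous_map strict_topology strict_topology T \<and>
    (\<forall>a\<in>C0. \<forall>b\<in>C0. T (tensor a b) = cb_scale (\<mu> b) a)"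
    using T unfolding strict_linear_def by simp
next
  fix S :: "(('a \<times> 'a) \<Rightarrow>\<^sub>C complex) \<Rightarrow> ('a \<Rightarrow>\<^sub>C complex)"
  assume "Vector_Spaces.linear cb_scale cb_scale S \<and> continuous_map strict_topology strict_topology S \<and>
    (\<forall>a\<in>C0. \<forall>b\<in>C0. S (tensor a b) = cb_scale (\<mu> b) a)"
  then show "S = T"
    by (intro strict_linear_eq_on_tensors[OF lc lc lc _ T(1)]) (simp_all add: strict_linear_def T(2))
qed

lemma slice_id_eqI:
  fixes \<mu> :: "('a::t2_space \<Rightarrow>\<^sub>C complex) \<Rightarrow> complex"
  assumes lc: "locally_compact_space (euclidean :: 'a topology)"
    and T: "strict_linear T" "\<And>a b. a \<in> C0 \<Longrightarrow> b \<in> C0 \<Longrightarrow> T (tensor a b) = cb_scale (\<mu> a) b"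
  shows "slice_id \<mu> = T"
  unfolding slice_id_def
proof (rule the_equality)
  show "Vector_Spaces.linear cb_scale cb_scale T \<and> continuous_map strict_topology strict_topology T \<and>
    (\<forall>a\<in>C0. \<forall>b\<in>C0. T (tensor a b) = cb_scale (\<mu> a) b)"
    using T unfolding strict_linear_def by simp
next
  fix S :: "(('a \<times> 'a) \<Rightarrow>\<^sub>C complex) \<Rightarrow> ('a \<Rightarrow>\<^sub>C complex)"
  assume "Vector_Spaces.linear cb_scale cb_scale S \<and> continuous_map strict_topology strict_topology S \<and>
    (\<forall>a\<in>C0. \<forall>b\<in>C0. S (tensor a b) = cb_scale (\<mu> a) b)"
  then show "S = T"
    by (intro strict_linear_eq_on_tensors[OF lc lc lc _ T(1)]) (simp_all add: strict_linear_def T(2))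
qed

lemma
  fixes \<mu> :: "('a::t2_space \<Rightarrow>\<^sub>C complex) \<Rightarrow> complex"
  assumes lc: "locally_compact_space (euclidean :: 'a topology)" and mu: "\<mu> \<in> C0_dual"
  shows strict_linear_id_slice: "strict_linear (id_slice \<mu>)"
    and id_slice_tensor: "a \<in> C0 \<Longrightarrow> b \<in> C0 \<Longrightarrow> id_slice \<mu> (tensor a b) = cb_scale (\<mu> b) a"
proof -
  obtain T :: "(('a \<times> 'a) \<Rightarrow>\<^sub>C complex) \<Rightarrow> ('a \<Rightarrow>\<^sub>C complex)"
    where T: "strict_linear T" "\<And>a b. a \<in> C0 \<Longrightarrow> b \<in> C0 \<Longrightarrow> T (tensor a b) = cb_scale (\<mu> b) a"
    using slice_exists[OF mu] by blast
  have "id_slice \<mu> = T" by (rule id_slice_eqI[OF lc T])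
  then show "strict_linear (id_slice \<mu>)" "a \<in> C0 \<Longrightarrow> b \<in> C0 \<Longrightarrow> id_slice \<mu> (tensor a b) = cb_scale (\<mu> b) a"
    using T by simp_all
qed

lemma
  fixes \<mu> :: "('a::t2_space \<Rightarrow>\<^sub>C complex) \<Rightarrow> complex"
  assumes lc: "locally_compact_space (euclidean :: 'a topology)" and mu: "\<mu> \<in> C0_dual"
  shows strict_linear_slice_id: "strict_linear (slice_id \<mu>)"
    and slice_id_tensor: "a \<in> C0 \<Longrightarrow> b \<in> C0 \<Longrightarrow> slice_id \<mu> (tensor a b) = cb_scale (\<mu> a) b"
proof -
  have swap: "cb_swap (tensor a b) = tensor b a" for a b :: "'a \<Rightarrow>\<^sub>C complex"
    by (rule bcontfun_eqI) (auto simp: split_paired_all)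
  have "slice_id \<mu> = (\<lambda>F. id_slice \<mu> (cb_swap F))"
    by (rule slice_id_eqI[OF lc strict_linear_compose[OF strict_linear_swap strict_linear_id_slice[OF lc mu]]])
      (simp add: swap id_slice_tensor[OF lc mu])
  then show "strict_linear (slice_id \<mu>)" "a \<in> C0 \<Longrightarrow> b \<in> C0 \<Longrightarrow> slice_id \<mu> (tensor a b) = cb_scale (\<mu> a) b"
    using strict_linear_compose[OF strict_linear_swap strict_linear_id_slice[OF lc mu]]
    by (simp_all add: swap id_slice_tensor[OF lc mu])
qed

text \<open>
  \<open>(\<mu> \<cdot> f) \<otimes> id\<close> agrees with \<open>F \<mapsto> (\<mu> \<otimes> id) ((f \<otimes> 1) F)\<close> on elementary tensors, and both are strictly
  continuous.
\<close>

lemma slice_id_right_act: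
  fixes \<mu> :: "('a::t2_space \<Rightarrow>\<^sub>C complex) \<Rightarrow> complex"
  assumes lc: "locally_compact_space (euclidean :: 'a topology)" and mu: "\<mu> \<in> C0_dual" and f: "f \<in> C0"
  shows "slice_id (right_act \<mu> f) F = slice_id \<mu> (F \<bullet>\<^sub>C tensor f (const_bcontfun 1))"
proof -
  have "slice_id (right_act \<mu> f) = (\<lambda>F. slice_id \<mu> (F \<bullet>\<^sub>C tensor f (const_bcontfun 1)))"
  proof (rule slice_id_eqI[OF lc strict_linear_compose[OF strict_linear_mult strict_linear_slice_id[OF lc mu]]])
    fix a b :: "'a \<Rightarrow>\<^sub>C complex" assume ab: "a \<in> C0" "b \<in> C0"
    have "tensor a b \<bullet>\<^sub>C tensor f (const_bcontfun 1) = tensor (f \<bullet>\<^sub>C a) b"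
      by (rule bcontfun_eqI) (auto simp: split_paired_all)
    then show "slice_id \<mu> (tensor a b \<bullet>\<^sub>C tensor f (const_bcontfun 1)) = cb_scale (right_act \<mu> f a) b"
      by (simp add: slice_id_tensor[OF lc mu C0_mult_left[OF f] ab(2)] right_act_def)
  qed
  then show ?thesis by simp
qed

lemma id_slice_left_act:
  fixes \<mu> :: "('a::t2_space \<Rightarrow>\<^sub>C complex) \<Rightarrow> complex"
  assumes lc: "locally_compact_space (euclidean :: 'a topology)" and mu: "\<mu> \<in> C0_dual" and g: "g \<in> C0"
  shows "id_slice (left_act g \<mu>) F = id_slice \<mu> (F \<bullet>\<^sub>C tensor (const_bcontfun 1) g)"
proof -
  have "id_slice (left_act g \<mu>) = (\<lambda>F. id_slice \<mu> (F \<bullet>\<^sub>C tensor (const_bcontfun 1) g))"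
  proof (rule id_slice_eqI[OF lc strict_linear_compose[OF strict_linear_mult strict_linear_id_slice[OF lc mu]]])
    fix a b :: "'a \<Rightarrow>\<^sub>C complex" assume ab: "a \<in> C0" "b \<in> C0"
    have "tensor a b \<bullet>\<^sub>C tensor (const_bcontfun 1) g = tensor a (b \<bullet>\<^sub>C g)"
      by (rule bcontfun_eqI) (auto simp: split_paired_all)
    then show "id_slice \<mu> (tensor a b \<bullet>\<^sub>C tensor (const_bcontfun 1) g) = cb_scale (left_act g \<mu> b) a"
      by (simp add: id_slice_tensor[OF lc mu ab(1) C0_mult_right[OF g]] left_act_def)
  qed
  then show ?thesis by simp
qed


section \<open>Density and cancellation\<close>

lemma subspace_C0: "cb.subspace C0"
  unfolding cb.subspace_def by (simp add: C0_0 C0_add C0_scale)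

lemma strictly_dense_C0:
  assumes lc: "locally_compact_space (euclidean :: 'a::t2_space topology)"
  shows "strictly_dense (C0 :: ('a \<Rightarrow>\<^sub>C complex) set)"
proof -
  have "strictly_dense (cb.span (C0 :: ('a \<Rightarrow>\<^sub>C complex) set))"
  proof (rule strict_Stone_Weierstrass)
    fix x y :: 'a
    show "\<exists>f\<in>C0. f x \<noteq> f y" if "x \<noteq> y"
      by (rule C0_separates[OF lc that]) force
    show "\<exists>f\<in>C0. f x \<noteq> 0"
      by (rule C0_nonvanishing[OF lc, of x]) force
  qed (auto intro: C0_mult_left C0_cnj)
  then show ?thesis using cb.span_eq_iff subspace_C0 by metis
qed

text \<open>
  The image of a strictly dense set is dense in the range of \<open>T\<close>, and this range is itself dense.
\<close>

lemma strictly_dense_span_image: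
  fixes T :: "('a::topological_space \<Rightarrow>\<^sub>C complex) \<Rightarrow> ('b::t2_space \<Rightarrow>\<^sub>C complex)"
  assumes lc: "locally_compact_space (euclidean :: 'b topology)"
    and T: "strict_linear T" and ran: "C0 \<subseteq> range T" and G: "strictly_dense (cb.span G)"
  shows "strictly_dense (cb.span (T ` G))"
proof -
  have hom: "module_hom cb_scale cb_scale T"
    using T by (simp add: strict_linear_def module_hom_iff_linear)
  have "C0 \<subseteq> T ` (strict_topology closure_of (cb.span G))"
    using ran G by (simp add: strictly_dense_def)
  also have "\<dots> \<subseteq> strict_topology closure_of (T ` cb.span G)"
    using T by (intro continuous_map_image_closure_subset) (simp add: strict_linear_def)
  also have "T ` cb.span G = cb.span (T ` G)"
    by (rule module_hom.span_image[OF hom, symmetric])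
  finally have "strict_topology closure_of C0 \<subseteq>
      strict_topology closure_of (strict_topology closure_of (cb.span (T ` G)))"
    by (rule closure_of_mono)
  then show ?thesis
    using strictly_dense_C0[OF lc] unfolding strictly_dense_def closure_of_closure_of by blast
qed

text \<open>
  Choose \<open>f\<close> with different values at the two points. An \<open>h\<close> strictly close to \<open>f\<close>, measured against
  a \<open>c\<close> that is at least one in modulus at both points, has different values there as well.
\<close>

lemma strictly_dense_separates:
  fixes x y :: "'a::t2_space"
  assumes lc: "locally_compact_space (euclidean :: 'a topology)"
    and X: "strictly_dense X" and "x \<noteq> y"
  obtains h where "h \<in> X" "h x \<noteq> h y"
proof -
  obtain f where f: "f \<in> C0" "f x = 1" "f y = 0"
    by (rule C0_separates[OF lc \<open>x \<noteq> y\<close>])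
  obtain a b where ab: "a \<in> C0" "a x = 1" "b \<in> C0" "b y = 1"
    using C0_nonvanishing[OF lc] by metis
  obtain c where c: "c \<in> C0" "\<And>z. norm (a z) \<le> norm (c z)" "\<And>z. norm (b z) \<le> norm (c z)"
    using C0_common_dominator[OF ab(1,3)] by blast
  have c1: "1 \<le> norm (c x)" "1 \<le> norm (c y)" using c(2)[of x] c(3)[of y] ab by simp_all
  obtain h where h: "h \<in> X" "norm ((h - f) \<bullet>\<^sub>C c) < 1/2"
    using X c(1) unfolding strictly_dense_iff by (metis half_gt_zero zero_less_one)
  have near: "norm (h z - f z) < 1/2" if "1 \<le> norm (c z)" for z
  proof -
    have "norm (h z - f z) \<le> norm (h z - f z) * norm (c z)"
      using that mult_left_mono[of 1 "norm (c z)" "norm (h z - f z)"] by simp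
    also have "\<dots> \<le> norm ((h - f) \<bullet>\<^sub>C c)"
      using norm_bounded[of "(h - f) \<bullet>\<^sub>C c" z] by (simp add: norm_mult)
    finally show ?thesis using h(2) by simp
  qed
  have "h x \<noteq> h y"
  proof
    assume "h x = h y"
    then have "norm (1 :: complex) \<le> norm (h y) + norm (h x - 1)"
      using norm_triangle_ineq4[of "h y" "h x - 1"] by simp
    then show False using near[OF c1(1)] near[OF c1(2)] f by simp
  qed
  then show thesis using that h(1) by blast
qed

lemma span_eq_at:
  fixes G :: "('a::topological_space \<Rightarrow>\<^sub>C complex) set"
  assumes "\<And>g. g \<in> G \<Longrightarrow> g x = g y" "h \<in> cb.span G"
  shows "h x = h y"
  using assms(2) by (induction rule: cb.span_induct_alt) (simp_all add: assms(1))

definition point_evaluation :: "'a::topological_space \<Rightarrow> ('a \<Rightarrow>\<^sub>C complex) \<Rightarrow> complex"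
  where "point_evaluation x f = f x"

lemma point_evaluation_C0_dual: "point_evaluation x \<in> C0_dual"
  unfolding C0_dual_def point_evaluation_def
  by (auto intro!: exI[of _ 1] norm_bounded)

text \<open>
  The slice by an evaluation restricts a function of two variables to a line. The definite
  descriptions are resolved by checking that this restriction is strictly continuous.
\<close>

lemma slices_point_evaluation:
  fixes x :: "'a::t2_space"
  assumes lc: "locally_compact_space (euclidean :: 'a topology)"
  shows slice_id_point_evaluation: "slice_id (point_evaluation x) F y = F (x, y)"
    and id_slice_point_evaluation: "id_slice (point_evaluation x) F y = F (y, x)"
proof -
  obtain e where e: "e \<in> C0" "e x = 1" using C0_nonvanishing[OF lc] by blast
  have sec: "strict_linear (\<lambda>F :: ('a \<times> 'a) \<Rightarrow>\<^sub>C complex. cb_section F x)"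
  proof (rule strict_linearI)
    show "\<exists>d\<in>C0. \<exists>C. \<forall>F :: ('a \<times> 'a) \<Rightarrow>\<^sub>C complex. norm (cb_section F x \<bullet>\<^sub>C c) \<le> C * norm (F \<bullet>\<^sub>C d)"
      if c: "c \<in> C0" for c
    proof (intro bexI exI allI)
      show "tensor e c \<in> C0" by (rule tensor_C0[OF e(1) c])
      show "norm (cb_section F x \<bullet>\<^sub>C c) \<le> 1 * norm (F \<bullet>\<^sub>C tensor e c)"
        for F :: "('a \<times> 'a) \<Rightarrow>\<^sub>C complex"
      proof (rule norm_bcontfun_mono)
        fix y
        show "\<exists>z. norm ((cb_section F x \<bullet>\<^sub>C c) y) \<le> 1 * norm ((F \<bullet>\<^sub>C tensor e c) z)"
          by (rule exI[of _ "(x, y)"]) (simp add: e(2))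
      qed simp
    qed
  qed (auto intro: bcontfun_eqI)
  have "slice_id (point_evaluation x) = (\<lambda>F. cb_section F x)"
    by (rule slice_id_eqI[OF lc sec]) (auto intro: bcontfun_eqI simp: point_evaluation_def)
  then show "slice_id (point_evaluation x) F y = F (x, y)" by simp
  have "id_slice (point_evaluation x) = (\<lambda>F. cb_section (cb_swap F) x)"
    by (rule id_slice_eqI[OF lc strict_linear_compose[OF strict_linear_swap sec]])
      (auto intro: bcontfun_eqI simp: point_evaluation_def)
  then show "id_slice (point_evaluation x) F y = F (y, x)" by simp
qed

text \<open>
  If \<open>\<mu> g = 1\<close>, then \<open>b\<close> is the slice of the elementary tensor of \<open>g\<close> and \<open>b\<close>.
\<close>

lemma C0_le_range_slices:
  fixes \<mu> :: "('a::t2_space \<Rightarrow>\<^sub>C complex) \<Rightarrow> complex"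
  assumes lc: "locally_compact_space (euclidean :: 'a topology)" and mu: "\<mu> \<in> C0_dual"
    and nz: "\<exists>f\<in>C0. \<mu> f \<noteq> 0"
  shows C0_le_range_slice_id: "C0 \<subseteq> range (slice_id \<mu>)"
    and C0_le_range_id_slice: "C0 \<subseteq> range (id_slice \<mu>)"
proof -
  obtain f where f: "f \<in> C0" "\<mu> f \<noteq> 0" using nz by blast
  define g where "g = cb_scale (inverse (\<mu> f)) f"
  have g: "g \<in> C0" "\<mu> g = 1"
    using f by (auto simp: g_def C0_scale C0_dual_scale[OF mu])
  show "C0 \<subseteq> range (slice_id \<mu>)"
  proof
    fix b :: "'a \<Rightarrow>\<^sub>C complex" assume "b \<in> C0"
    then have "b = slice_id \<mu> (tensor g b)" by (simp add: slice_id_tensor[OF lc mu] g)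
    then show "b \<in> range (slice_id \<mu>)" by blast
  qed
  show "C0 \<subseteq> range (id_slice \<mu>)"
  proof
    fix b :: "'a \<Rightarrow>\<^sub>C complex" assume "b \<in> C0"
    then have "b = id_slice \<mu> (tensor b g)" by (simp add: id_slice_tensor[OF lc mu] g)
    then show "b \<in> range (id_slice \<mu>)" by blast
  qed
qed

lemma strictly_dense_span_comult_left:
  assumes lc: "locally_compact_space (euclidean :: 'a::{t2_space, topological_semigroup_mult} topology)"
    and cancel: "\<And>x y y' :: 'a. x * y = x * y' \<Longrightarrow> y = y'"
  shows "strictly_dense (cb.span {comult g \<bullet>\<^sub>C tensor f (const_bcontfun 1) | f g :: 'a \<Rightarrow>\<^sub>C complex.
    f \<in> C0 \<and> g \<in> C0})"
proof (rule strictly_dense_span_pullback_products[OF lc lc, of fst "\<lambda>z. fst z * snd z"])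
  show "z = w" if "fst z = fst w" "fst z * snd z = fst w * snd w" for z w :: "'a \<times> 'a"
    using that cancel by (metis prod_eqI)
  show "(comult g \<bullet>\<^sub>C tensor f (const_bcontfun 1)) z = f (fst z) * g (fst z * snd z)"
    for f g :: "'a \<Rightarrow>\<^sub>C complex" and z
    by (cases z) simp
qed

lemma strictly_dense_span_comult_right:
  assumes lc: "locally_compact_space (euclidean :: 'a::{t2_space, topological_semigroup_mult} topology)"
    and cancel: "\<And>x x' y :: 'a. x * y = x' * y \<Longrightarrow> x = x'"
  shows "strictly_dense (cb.span {comult f \<bullet>\<^sub>C tensor (const_bcontfun 1) g | f g :: 'a \<Rightarrow>\<^sub>C complex.
    f \<in> C0 \<and> g \<in> C0})"
proof (rule strictly_dense_span_pullback_products[OF lc lc, of "\<lambda>z. fst z * snd z" snd])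
  show "z = w" if "fst z * snd z = fst w * snd w" "snd z = snd w" for z w :: "'a \<times> 'a"
    using that cancel by (metis prod_eqI)
  show "(comult f \<bullet>\<^sub>C tensor (const_bcontfun 1) g) z = f (fst z * snd z) * g (snd z)"
    for f g :: "'a \<Rightarrow>\<^sub>C complex" and z
    by (cases z) simp
qed

lemma conv_dual_right_act_image:
  fixes \<mu> :: "('a::{t2_space, topological_semigroup_mult} \<Rightarrow>\<^sub>C complex) \<Rightarrow> complex"
  assumes lc: "locally_compact_space (euclidean :: 'a topology)" and mu: "\<mu> \<in> C0_dual"
  shows "{conv_dual g (right_act \<mu> f) | f g. f \<in> C0 \<and> g \<in> C0} =
    slice_id \<mu> ` {comult g \<bullet>\<^sub>C tensor f (const_bcontfun 1) | f g. f \<in> C0 \<and> g \<in> C0}"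
    (is "?L = ?R")
proof -
  have eq: "conv_dual g (right_act \<mu> f) = slice_id \<mu> (comult g \<bullet>\<^sub>C tensor f (const_bcontfun 1))"
    if "f \<in> C0" for f g
    unfolding conv_dual_def by (rule slice_id_right_act[OF lc mu that])
  show ?thesis
  proof (intro equalityI subsetI)
    fix k assume "k \<in> ?L"
    then obtain f g where "f \<in> C0" "g \<in> C0" "k = conv_dual g (right_act \<mu> f)" by auto
    then have "k = slice_id \<mu> (comult g \<bullet>\<^sub>C tensor f (const_bcontfun 1))" using eq by simp
    with \<open>f \<in> C0\<close> \<open>g \<in> C0\<close> show "k \<in> ?R" by (intro image_eqI) auto
  next
    fix k assume "k \<in> ?R"
    then obtain f g where "f \<in> C0" "g \<in> C0" "k = slice_id \<mu> (comult g \<bullet>\<^sub>C tensor f (const_bcontfun 1))" by auto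
    then have "k = conv_dual g (right_act \<mu> f)" using eq by simp
    with \<open>f \<in> C0\<close> \<open>g \<in> C0\<close> show "k \<in> ?L" by auto
  qed
qed

lemma dual_conv_left_act_image:
  fixes \<mu> :: "('a::{t2_space, topological_semigroup_mult} \<Rightarrow>\<^sub>C complex) \<Rightarrow> complex"
  assumes lc: "locally_compact_space (euclidean :: 'a topology)" and mu: "\<mu> \<in> C0_dual"
  shows "{dual_conv (left_act g \<mu>) f | f g. f \<in> C0 \<and> g \<in> C0} =
    id_slice \<mu> ` {comult f \<bullet>\<^sub>C tensor (const_bcontfun 1) g | f g. f \<in> C0 \<and> g \<in> C0}"
    (is "?L = ?R")
proof -
  have eq: "dual_conv (left_act g \<mu>) f = id_slice \<mu> (comult f \<bullet>\<^sub>C tensor (const_bcontfun 1) g)"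
    if "g \<in> C0" for f g
    unfolding dual_conv_def by (rule id_slice_left_act[OF lc mu that])
  show ?thesis
  proof (intro equalityI subsetI)
    fix k assume "k \<in> ?L"
    then obtain f g where "f \<in> C0" "g \<in> C0" "k = dual_conv (left_act g \<mu>) f" by auto
    then have "k = id_slice \<mu> (comult f \<bullet>\<^sub>C tensor (const_bcontfun 1) g)" using eq by simp
    with \<open>f \<in> C0\<close> \<open>g \<in> C0\<close> show "k \<in> ?R" by (intro image_eqI) auto
  next
    fix k assume "k \<in> ?R"
    then obtain f g where "f \<in> C0" "g \<in> C0" "k = id_slice \<mu> (comult f \<bullet>\<^sub>C tensor (const_bcontfun 1) g)" by auto
    then have "k = dual_conv (left_act g \<mu>) f" using eq by simp
    with \<open>f \<in> C0\<close> \<open>g \<in> C0\<close> show "k \<in> ?L" by auto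
  qed
qed

theorem proposition1p3:
  assumes "locally_compact_space (euclidean :: 'a::{t2_space, topological_semigroup_mult} topology)"
  shows
    "((\<forall>x y y' :: 'a. x * y = x * y' \<longrightarrow> y = y') \<and> (\<forall>x x' y :: 'a. x * y = x' * y \<longrightarrow> x = x'))
     \<longleftrightarrow>
     (\<forall>\<mu> :: ('a \<Rightarrow>\<^sub>C complex) \<Rightarrow> complex. \<mu> \<in> C0_dual \<and> (\<exists>f\<in>C0. \<mu> f \<noteq> 0) \<longrightarrow>
        strictly_dense (module.span cb_scale {conv_dual g (right_act \<mu> f) | f g. f \<in> C0 \<and> g \<in> C0}) \<and>
        strictly_dense (module.span cb_scale {dual_conv (left_act g \<mu>) f | f g. f \<in> C0 \<and> g \<in> C0}))"
    (is "?cancel \<longleftrightarrow> ?dense")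
proof
  note lc = assms
  assume cancel: ?cancel
  show ?dense
  proof (intro allI impI conjI; elim conjE)
    fix \<mu> :: "('a \<Rightarrow>\<^sub>C complex) \<Rightarrow> complex"
    assume mu: "\<mu> \<in> C0_dual" and nz: "\<exists>f\<in>C0. \<mu> f \<noteq> 0"
    show "strictly_dense (cb.span {conv_dual g (right_act \<mu> f) | f g. f \<in> C0 \<and> g \<in> C0})"
      unfolding conv_dual_right_act_image[OF lc mu]
      using cancel
      by (intro strictly_dense_span_image[OF lc strict_linear_slice_id[OF lc mu] C0_le_range_slice_id[OF lc mu nz]]
          strictly_dense_span_comult_left[OF lc]) metis
    show "strictly_dense (cb.span {dual_conv (left_act g \<mu>) f | f g. f \<in> C0 \<and> g \<in> C0})"
      unfolding dual_conv_left_act_image[OF lc mu]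
      using cancel
      by (intro strictly_dense_span_image[OF lc strict_linear_id_slice[OF lc mu] C0_le_range_id_slice[OF lc mu nz]]
          strictly_dense_span_comult_right[OF lc]) metis
  qed
next
  note lc = assms
  assume dense: ?dense
  have dx: "strictly_dense (cb.span {conv_dual g (right_act (point_evaluation x) f) | f g. f \<in> C0 \<and> g \<in> C0})"
    "strictly_dense (cb.span {dual_conv (left_act g (point_evaluation x)) f | f g. f \<in> C0 \<and> g \<in> C0})"
    for x :: 'a
  proof -
    obtain f where "f \<in> C0" "f x = 1" using C0_nonvanishing[OF lc] by blast
    then have "\<exists>f\<in>C0. point_evaluation x f \<noteq> 0"
      by (intro bexI[of _ f]) (simp_all add: point_evaluation_def)
    then show "strictly_dense (cb.span {conv_dual g (right_act (point_evaluation x) f) | f g. f \<in> C0 \<and> g \<in> C0})"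
      "strictly_dense (cb.span {dual_conv (left_act g (point_evaluation x)) f | f g. f \<in> C0 \<and> g \<in> C0})"
      using dense point_evaluation_C0_dual[of x] by simp_all
  qed
  show ?cancel
  proof (intro conjI allI impI)
    fix x y y' :: 'a assume eq: "x * y = x * y'"
    show "y = y'"
    proof (rule ccontr)
      assume "y \<noteq> y'"
      then obtain h where h: "h \<in> cb.span {conv_dual g (right_act (point_evaluation x) f) | f g. f \<in> C0 \<and> g \<in> C0}"
        "h y \<noteq> h y'"
        by (rule strictly_dense_separates[OF lc dx(1)])
      have "h y = h y'"
      proof (rule span_eq_at[OF _ h(1)])
        fix k assume "k \<in> {conv_dual g (right_act (point_evaluation x) f) | f g. f \<in> C0 \<and> g \<in> C0}"
        then show "k y = k y'"
          unfolding conv_dual_right_act_image[OF lc point_evaluation_C0_dual]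
          by (auto simp: slice_id_point_evaluation[OF lc] eq)
      qed
      then show False using h(2) by contradiction
    qed
  next
    fix x x' y :: 'a assume eq: "x * y = x' * y"
    show "x = x'"
    proof (rule ccontr)
      assume "x \<noteq> x'"
      then obtain h where h: "h \<in> cb.span {dual_conv (left_act g (point_evaluation y)) f | f g. f \<in> C0 \<and> g \<in> C0}"
        "h x \<noteq> h x'"
        by (rule strictly_dense_separates[OF lc dx(2)])
      have "h x = h x'"
      proof (rule span_eq_at[OF _ h(1)])
        fix k assume "k \<in> {dual_conv (left_act g (point_evaluation y)) f | f g. f \<in> C0 \<and> g \<in> C0}"
        then show "k x = k x'"
          unfolding dual_conv_left_act_image[OF lc point_evaluation_C0_dual]
          by (auto simp: id_slice_point_evaluation[OF lc] eq)
      qed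
      then show False using h(2) by contradiction
    qed
  qed
qed

end
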